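(* Let $V$ be an $n$-dimensional vector space over $\mathbb{F}_q$, let $2\leq s<n$, and let $\mathcal{F}\subseteq\mathcal{L}(V)$ be an $s$-union antichain. Then: (i) $|\mathcal{F}|\leq\left[n\atop \lfloor s/2\rfloor\right]$. Moreover, equality holds if and only if either (a) $\mathcal{F}=\left[V\atop \lfloor s/2\rfloor\right]$; or (b) $s=2d+1$ and $\mathcal{F}=\mathcal{F}_d\cup\mathcal{F}_{d+1}$, where $\mathcal{F}_{d+1}\subseteq\left[V\atop d+1\right]$, $\mathcal{F}_d=\left[V\atop d\right]\setminus\bigtriangleup(\mathcal{F}_{d+1})$ and $|\bigtriangleup(\mathcal{F}_{d+1})|=|\mathcal{F}_{d+1}|$. (ii) Suppose $s=2d$ and $\mathcal{F}\nsubseteq\left[V\atop d\right]$. (a) If $d=1$, then $|\mathcal{F}|\leq\left[n\atop 1\right]-q$, with equality if and only if $\mathcal{F}=\mathcal{B}[n,2]$. (b) If $d\geq 2$, then $|\mathcal{F}|\leq\left[n\atop d\right]-q\left[n-d\atop 1\right]$, with equality if and only if $\mathcal{F}=\mathcal{A}[n,2d]$.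
   Context: $\left[m\atop k\right]=\prod_{0\leq i<k}\frac{q^{m-i}-1}{q^{k-i}-1}$ is the Gaussian binomial coefficient; $\left[V\atop k\right]$ is the set of $k$-dimensional subspaces of $V$ and $\mathcal{L}(V)$ the set of all subspaces. $\mathcal{F}$ is $s$-union if $\dim(F+F')\leq s$ for all $F,F'\in\mathcal{F}$, and an antichain if $F\nleq F'$ for distinct $F,F'\in\mathcal{F}$. For $\mathcal{H}\subseteq\left[V\atop u\right]$, the shadow is $\bigtriangleup(\mathcal{H})=\{G\in\left[V\atop u-1\right]:G\leq H\text{ for some }H\in\mathcal{H}\}$. $\mathcal{A}[n,s]=(\left[V\atop \lceil s/2\rceil\right]\setminus\{F\in\left[V\atop \lceil s/2\rceil\right]:U\leq F\})\cup\{U\}$ with $U$ a fixed $(\lceil s/2\rceil-1)$-dimensional subspace; $\mathcal{B}[n,s]=(\left[V\atop \lfloor s/2\rfloor\right]\setminus\{F\in\left[V\atop \lfloor s/2\rfloor\right]:F\leq W\})\cup\{W\}$ with $W$ a fixed $(\lfloor s/2\rfloor+1)$-dimensional subspace. *)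

theory Defs
  imports Complex_Main "HOL-Library.Cardinality"
begin

text \<open>For \<open>k > m\<close> the truncated subtraction is harmless: the factor \<open>i = m\<close> vanishes, so the
  product is \<open>0\<close>.\<close>

definition gauss_binomial :: "nat \<Rightarrow> nat \<Rightarrow> nat \<Rightarrow> real" where
  "gauss_binomial q m k = (\<Prod>i<k. (real q ^ (m - i) - 1) / (real q ^ (k - i) - 1))"

text \<open>The vector space \<open>V\<close> is the whole type \<open>'b\<close> with scalar multiplication \<open>scale\<close>. The
  definitions are not made inside the locale \<^locale>\<open>vector_space\<close> because its interpretation for
  real vector spaces would capture the new names.\<close>

definition all_subspaces :: "('a::field \<Rightarrow> 'b::ab_group_add \<Rightarrow> 'b) \<Rightarrow> 'b set set" where
  "all_subspaces scale = {F. module.subspace scale F}"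

definition subspaces_of_dim :: "('a::field \<Rightarrow> 'b::ab_group_add \<Rightarrow> 'b) \<Rightarrow> nat \<Rightarrow> 'b set set" where
  "subspaces_of_dim scale k = {F. module.subspace scale F \<and> vector_space.dim scale F = k}"

definition s_union :: "('a::field \<Rightarrow> 'b::ab_group_add \<Rightarrow> 'b) \<Rightarrow> nat \<Rightarrow> 'b set set \<Rightarrow> bool" where
  "s_union scale s \<F> \<longleftrightarrow>
    (\<forall>F\<in>\<F>. \<forall>F'\<in>\<F>. vector_space.dim scale {x + y | x y. x \<in> F \<and> y \<in> F'} \<le> s)"

definition subspace_antichain :: "'b set set \<Rightarrow> bool" where
  "subspace_antichain \<F> \<longleftrightarrow> (\<forall>F\<in>\<F>. \<forall>F'\<in>\<F>. F \<noteq> F' \<longrightarrow> \<not> F \<subseteq> F')"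

text \<open>The shadow of a family \<open>\<H>\<close> of \<open>u\<close>-dimensional subspaces; stating the dimension of \<open>G\<close> as
  an equation avoids truncated subtraction at \<open>u = 0\<close>.\<close>

definition shadow ::
  "('a::field \<Rightarrow> 'b::ab_group_add \<Rightarrow> 'b) \<Rightarrow> nat \<Rightarrow> 'b set set \<Rightarrow> 'b set set" where
  "shadow scale u \<H> =
    {G. module.subspace scale G \<and> vector_space.dim scale G + 1 = u \<and> (\<exists>H\<in>\<H>. G \<subseteq> H)}"

text \<open>The families \<open>\<A>[n,s]\<close> and \<open>\<B>[n,s]\<close>, with the fixed subspace as an explicit argument.
  Here \<open>\<lfloor>s/2\<rfloor>\<close> is \<^term>\<open>s div 2\<close> and \<open>\<lceil>s/2\<rceil>\<close> is \<^term>\<open>(s + 1) div 2\<close>. The predicates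
  \<open>is_family_A\<close> and \<open>is_family_B\<close> say that \<open>\<F>\<close> is such a family for some choice of the fixed
  subspace, of dimension \<open>\<lceil>s/2\<rceil> - 1\<close> and \<open>\<lfloor>s/2\<rfloor> + 1\<close> respectively.\<close>

definition family_A ::
  "('a::field \<Rightarrow> 'b::ab_group_add \<Rightarrow> 'b) \<Rightarrow> nat \<Rightarrow> 'b set \<Rightarrow> 'b set set" where
  "family_A scale s U =
    (subspaces_of_dim scale ((s + 1) div 2) -
      {F \<in> subspaces_of_dim scale ((s + 1) div 2). U \<subseteq> F}) \<union> {U}"

definition family_B ::
  "('a::field \<Rightarrow> 'b::ab_group_add \<Rightarrow> 'b) \<Rightarrow> nat \<Rightarrow> 'b set \<Rightarrow> 'b set set" where
  "family_B scale s W =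
    (subspaces_of_dim scale (s div 2) -
      {F \<in> subspaces_of_dim scale (s div 2). F \<subseteq> W}) \<union> {W}"

definition is_family_A ::
  "('a::field \<Rightarrow> 'b::ab_group_add \<Rightarrow> 'b) \<Rightarrow> nat \<Rightarrow> 'b set set \<Rightarrow> bool" where
  "is_family_A scale s \<F> \<longleftrightarrow>
    (\<exists>U\<in>subspaces_of_dim scale ((s + 1) div 2 - 1). \<F> = family_A scale s U)"

definition is_family_B ::
  "('a::field \<Rightarrow> 'b::ab_group_add \<Rightarrow> 'b) \<Rightarrow> nat \<Rightarrow> 'b set set \<Rightarrow> bool" where
  "is_family_B scale s \<F> \<longleftrightarrow>
    (\<exists>W\<in>subspaces_of_dim scale (s div 2 + 1). \<F> = family_B scale s W)"

end

theory Submission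
  imports Defs "HOL-Computational_Algebra.Polynomial" "HOL-Library.FuncSet"
begin

text \<open>Let \<open>d = \<lfloor>s/2\<rfloor>\<close>. Members of dimension \<open>u > d\<close> meet pairwise nontrivially, and such a family
  is at most as large as its shadow: the incidence matrix of the family against the
  \<open>(u-1)\<close>-subspaces has full row rank. Hence the top layer can be replaced repeatedly by its shadow,
  until all dimensions are at most \<open>d\<close>; since \<open>n > 2d\<close>, layers below \<open>d\<close> can then be replaced by
  their upper shadows with strict gain. This bounds \<open>|\<F>|\<close> by the number of \<open>d\<close>-subspaces.

  Every subspace occurring in the downward replacement lies below a member of \<open>\<F>\<close>. So if
  \<open>\<F>\<close> contains \<open>W\<close> with \<open>dim W + d > s\<close>, none of the \<open>q^(d(n-d))\<close> complements of an
  \<open>(n-d)\<close>-dimensional space containing a suitable part of \<open>W\<close> is reached. This large defect settles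
  uniqueness in (i) and eliminates members of dimension above \<open>d\<close> in (ii). What remains in (ii) is
  that the upper shadow of a nonempty family of \<open>(d-1)\<close>-subspaces exceeds it by at least
  \<open>q[n-d,1]\<close>, with equality only for a single subspace. For \<open>d = 1\<close>, part (ii) is degenerate:
  \<open>\<F>\<close> has one element and \<open>\<B>[n,2]\<close> is not 2-union.\<close>

section \<open>Linear systems, double counting and exchange in antichains\<close>

lemma underdetermined_system_nontrivial_solution:
  fixes M :: "'i \<Rightarrow> 'j \<Rightarrow> 'k::idom"
  assumes "finite B" "finite A" "card B < card A"
  shows "\<exists>x. (\<exists>a\<in>A. x a \<noteq> 0) \<and> (\<forall>b\<in>B. (\<Sum>a\<in>A. M b a * x a) = 0)"
  using assms
proof (induction B arbitrary: A M)
  case empty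
  then show ?case by (intro exI[of _ "\<lambda>_. 1"]) (auto simp: card_gt_0_iff)
next
  case (insert b B)
  show ?case
  proof (cases "\<forall>a\<in>A. M b a = 0")
    case True
    then show ?thesis
      using insert.IH[of A M] insert.prems insert.hyps by auto
  next
    case False
    then obtain p where p: "p \<in> A" "M b p \<noteq> 0" by blast
    define N where "N b' a = M b' a * M b p - M b' p * M b a" for b' a
    have "card B < card (A - {p})"
      using insert.prems insert.hyps p by simp
    then obtain x where x: "\<exists>a\<in>A - {p}. x a \<noteq> 0" "\<forall>b'\<in>B. (\<Sum>a\<in>A - {p}. N b' a * x a) = 0"
      using insert.IH[of "A - {p}" N] insert.prems by auto
    define y where "y a = (if a = p then - (\<Sum>a\<in>A - {p}. M b a * x a) else M b p * x a)" for a
    have "(\<Sum>a\<in>A. M b' a * y a) = (\<Sum>a\<in>A - {p}. N b' a * x a)" for b'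
    proof -
      have "(\<Sum>a\<in>A. M b' a * y a) = M b' p * y p + (\<Sum>a\<in>A - {p}. M b' a * y a)"
        using p insert.prems by (simp add: sum.remove)
      also have "(\<Sum>a\<in>A - {p}. M b' a * y a) = (\<Sum>a\<in>A - {p}. M b' a * (M b p * x a))"
        by (rule sum.cong) (auto simp: y_def)
      finally show ?thesis
        by (simp add: y_def N_def sum_distrib_left sum_subtractf algebra_simps)
    qed
    moreover have "N b a = 0" for a
      by (simp add: N_def)
    moreover have "\<exists>a\<in>A. y a \<noteq> 0"
      using x(1) p by (auto simp: y_def)
    ultimately show ?thesis
      using x(2) by (intro exI[of _ y]) auto
  qed
qed

lemma sum_mult_poly_eq_0:
  fixes x y :: "'i \<Rightarrow> 'k::comm_semiring_1"
  assumes "\<And>r. r \<le> degree p \<Longrightarrow> (\<Sum>i\<in>A. x i * y i ^ r) = 0"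
  shows "(\<Sum>i\<in>A. x i * poly p (y i)) = 0"
proof -
  have "(\<Sum>i\<in>A. x i * poly p (y i)) = (\<Sum>i\<in>A. \<Sum>r\<le>degree p. coeff p r * (x i * y i ^ r))"
    by (simp add: poly_altdef sum_distrib_left ac_simps)
  also have "\<dots> = (\<Sum>r\<le>degree p. coeff p r * (\<Sum>i\<in>A. x i * y i ^ r))"
    by (subst sum.swap) (simp add: sum_distrib_left)
  also have "\<dots> = 0"
    using assms by simp
  finally show ?thesis .
qed

lemma card_Diff_add:
  assumes "finite A" "B \<subseteq> A"
  shows "card (A - B) + card B = card A"
  using card_Int_Diff[OF assms(1), of B] assms(2) by (simp add: Int_absorb1)

lemma card_less_by_double_counting:
  fixes lo hi :: real
  assumes fin: "finite A" "finite B" and "A \<noteq> {}"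
    and lo: "\<And>a. a \<in> A \<Longrightarrow> lo \<le> real (card {b \<in> B. R a b})"
    and hi: "\<And>b. b \<in> B \<Longrightarrow> real (card {a \<in> A. R a b}) \<le> hi"
    and "0 \<le> hi" "hi < lo"
  shows "card A < card B"
proof (rule ccontr)
  assume "\<not> card A < card B"
  have "real (card A) * lo \<le> (\<Sum>a\<in>A. real (card {b \<in> B. R a b}))"
    using lo by (intro sum_bounded_below)
  also have "\<dots> = (\<Sum>b\<in>B. real (card {a \<in> A. R a b}))"
    using sum_multicount_gen[OF fin, of R "\<lambda>b. card {a \<in> A. R a b}"]
    by (simp flip: of_nat_sum)
  also have "\<dots> \<le> real (card B) * hi"
    using hi by (intro sum_bounded_above)
  also have "\<dots> \<le> real (card A) * hi"
    using \<open>\<not> card A < card B\<close> \<open>0 \<le> hi\<close> by (intro mult_right_mono) auto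
  also have "\<dots> < real (card A) * lo"
    using \<open>A \<noteq> {}\<close> \<open>hi < lo\<close> fin by (simp add: card_gt_0_iff)
  finally show False by simp
qed

text \<open>Stated for a relation so that it covers both \<open>\<subseteq>\<close> (lowering a layer) and \<open>\<supseteq>\<close> (raising one).\<close>

lemma antichain_exchange:
  assumes "transp R"
    and antichain: "\<And>x y. x \<in> A \<Longrightarrow> y \<in> A \<Longrightarrow> R x y \<Longrightarrow> x = y"
    and dominated: "\<And>y. y \<in> S \<Longrightarrow> \<exists>t\<in>A \<inter> T. R y t"
    and maximal: "\<And>x y. x \<in> S \<Longrightarrow> y \<in> A - T \<union> S \<Longrightarrow> R x y \<Longrightarrow> x = y"
    and xy: "x \<in> A - T \<union> S" "y \<in> A - T \<union> S" "R x y"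
  shows "x = y"
proof (cases "x \<in> S")
  case True
  then show ?thesis using maximal xy by blast
next
  case x: False
  show ?thesis
  proof (cases "y \<in> S")
    case True
    then obtain t where t: "t \<in> A \<inter> T" "R y t"
      using dominated by blast
    then have "R x t"
      using \<open>transp R\<close> xy(3) by (blast dest: transpD)
    then have "x = t"
      using antichain x xy t by blast
    then show ?thesis using x xy t by blast
  next
    case False
    then show ?thesis using antichain x xy by blast
  qed
qed

definition refines :: "'c set set \<Rightarrow> 'c set set \<Rightarrow> bool" where
  "refines \<G> \<F> \<longleftrightarrow> (\<forall>G\<in>\<G>. \<exists>F\<in>\<F>. G \<subseteq> F)"

lemma refines_refl: "refines \<F> \<F>"
  by (auto simp: refines_def)

lemma refines_trans: "refines \<K> \<G> \<Longrightarrow> refines \<G> \<F> \<Longrightarrow> refines \<K> \<F>"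
  unfolding refines_def by (meson order_trans)

section \<open>Gaussian binomial coefficients\<close>

lemma gauss_binomial_eq:
  assumes "2 \<le> q" "k \<le> m"
  shows "gauss_binomial q m k = (\<Prod>i<k. (real q ^ m - real q ^ i) / (real q ^ k - real q ^ i))"
  unfolding gauss_binomial_def
proof (rule prod.cong[OF refl])
  fix i assume "i \<in> {..<k}"
  then have "i \<le> k" "i \<le> m" using assms by auto
  then have "real q ^ m - real q ^ i = real q ^ i * (real q ^ (m - i) - 1)"
    "real q ^ k - real q ^ i = real q ^ i * (real q ^ (k - i) - 1)"
    by (auto simp: algebra_simps simp flip: power_add)
  then show "(real q ^ (m - i) - 1) / (real q ^ (k - i) - 1) =
      (real q ^ m - real q ^ i) / (real q ^ k - real q ^ i)"
    using assms by simp
qed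

lemma gauss_binomial_symmetric:
  assumes "2 \<le> q" "k \<le> m"
  shows "gauss_binomial q m (m - k) = gauss_binomial q m k"
proof -
  define P where "P j = (\<Prod>i<j. real q ^ (j - i) - 1)" for j
  have "1 < real q ^ (j - i)" if "i < j" for i j
    using assms that by (intro one_less_power) auto
  then have P_nz: "P j \<noteq> 0" for j
    by (force simp: P_def)
  have "gauss_binomial q m j = P m / (P j * P (m - j))" if "j \<le> m" for j
  proof -
    have "P m = (\<Prod>i<j. real q ^ (m - i) - 1) * (\<Prod>i=j..<m. real q ^ (m - i) - 1)"
      unfolding P_def using that
      by (simp add: lessThan_atLeast0 prod.atLeastLessThan_concat)
    also have "(\<Prod>i=j..<m. real q ^ (m - i) - 1) = P (m - j)"
      unfolding P_def using that
      by (intro prod.reindex_bij_witness[of _ "\<lambda>i. i + j" "\<lambda>i. i - j"]) auto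
    finally show ?thesis
      using P_nz by (simp add: gauss_binomial_def prod_dividef flip: P_def)
  qed
  then show ?thesis
    using assms by (simp add: mult.commute)
qed

lemma gauss_binomial_1: "gauss_binomial q m 1 = (real q ^ m - 1) / (real q - 1)"
  by (simp add: gauss_binomial_def)

lemma gauss_binomial_Suc_1:
  "2 \<le> q \<Longrightarrow> gauss_binomial q (Suc m) 1 = 1 + real q * gauss_binomial q m 1"
  unfolding gauss_binomial_1 by (simp add: field_simps)

lemma gauss_binomial_1_less:
  "2 \<le> q \<Longrightarrow> m < k \<Longrightarrow> gauss_binomial q m 1 < gauss_binomial q k 1"
  unfolding gauss_binomial_1 by (simp add: divide_strict_right_mono)

lemma gauss_binomial_1_gt_1: "2 \<le> q \<Longrightarrow> 2 \<le> m \<Longrightarrow> 1 < gauss_binomial q m 1"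
  using gauss_binomial_1_less[of q 1 m] by (simp add: gauss_binomial_def)

lemma gauss_binomial_1_nonneg: "2 \<le> q \<Longrightarrow> 0 \<le> gauss_binomial q m 1"
  unfolding gauss_binomial_1 by simp

lemma gauss_binomial_1_less_power:
  assumes "2 \<le> q"
  shows "gauss_binomial q m 1 < real q ^ m"
proof -
  have "gauss_binomial q m 1 \<le> (real q ^ m - 1) / 1"
    unfolding gauss_binomial_1 using assms by (intro divide_left_mono) auto
  then show ?thesis by simp
qed

lemma gauss_binomial_Suc_1_less_power:
  assumes "2 \<le> q" "2 \<le> d" "0 < m"
  shows "gauss_binomial q (Suc m) 1 < real (q ^ (d * m))"
proof -
  have "Suc m \<le> 2 * m" using assms by simp
  also have "\<dots> \<le> d * m" using assms by (intro mult_right_mono) auto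
  finally have "real q ^ Suc m \<le> real q ^ (d * m)"
    using assms by (intro power_increasing) auto
  then show ?thesis
    using gauss_binomial_1_less_power[OF assms(1), of "Suc m"] by simp
qed

section \<open>Shadows and antichains of subspaces\<close>

definition upper_shadow ::
  "('a::field \<Rightarrow> 'b::ab_group_add \<Rightarrow> 'b) \<Rightarrow> nat \<Rightarrow> 'b set set \<Rightarrow> 'b set set" where
  "upper_shadow scale l \<H> = {G \<in> subspaces_of_dim scale (Suc l). \<exists>H\<in>\<H>. H \<subseteq> G}"

definition lower_layer ::
  "('a::field \<Rightarrow> 'b::ab_group_add \<Rightarrow> 'b) \<Rightarrow> nat \<Rightarrow> 'b set set \<Rightarrow> 'b set set" where
  "lower_layer scale u \<F> =
    \<F> - subspaces_of_dim scale u \<union> shadow scale u (\<F> \<inter> subspaces_of_dim scale u)"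

definition raise_layer ::
  "('a::field \<Rightarrow> 'b::ab_group_add \<Rightarrow> 'b) \<Rightarrow> nat \<Rightarrow> 'b set set \<Rightarrow> 'b set set" where
  "raise_layer scale l \<F> =
    \<F> - subspaces_of_dim scale l \<union> upper_shadow scale l (\<F> \<inter> subspaces_of_dim scale l)"

lemma subspace_antichainD:
  "subspace_antichain \<F> \<Longrightarrow> F \<in> \<F> \<Longrightarrow> F' \<in> \<F> \<Longrightarrow> F \<subseteq> F' \<Longrightarrow> F = F'"
  by (auto simp: subspace_antichain_def)

lemma shadow_subset_subspaces_of_dim: "shadow scale (Suc u) \<H> \<subseteq> subspaces_of_dim scale u"
  by (auto simp: shadow_def subspaces_of_dim_def)

lemma upper_shadow_subset_subspaces_of_dim:
  "upper_shadow scale l \<H> \<subseteq> subspaces_of_dim scale (Suc l)"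
  by (auto simp: upper_shadow_def)

lemma upper_shadow_mono: "\<K> \<subseteq> \<H> \<Longrightarrow> upper_shadow scale l \<K> \<subseteq> upper_shadow scale l \<H>"
  by (auto simp: upper_shadow_def)

lemma antichain_Int_shadow:
  assumes "subspace_antichain \<F>"
  shows "\<F> \<inter> shadow scale u (\<F> \<inter> subspaces_of_dim scale u) = {}"
  using subspace_antichainD[OF assms] by (force simp: shadow_def subspaces_of_dim_def)

lemma antichain_Int_upper_shadow:
  assumes "subspace_antichain \<F>"
  shows "\<F> \<inter> upper_shadow scale l (\<F> \<inter> subspaces_of_dim scale l) = {}"
  using subspace_antichainD[OF assms] by (force simp: upper_shadow_def subspaces_of_dim_def)

lemma refines_lower_layer: "refines (lower_layer scale u \<F>) \<F>"
  by (auto simp: refines_def lower_layer_def shadow_def)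

lemma lower_layer_subset_all_subspaces:
  "\<F> \<subseteq> all_subspaces scale \<Longrightarrow> lower_layer scale u \<F> \<subseteq> all_subspaces scale"
  by (auto simp: lower_layer_def shadow_def all_subspaces_def)

lemma raise_layer_subset_all_subspaces:
  "\<F> \<subseteq> all_subspaces scale \<Longrightarrow> raise_layer scale l \<F> \<subseteq> all_subspaces scale"
  by (auto simp: raise_layer_def upper_shadow_def subspaces_of_dim_def all_subspaces_def)

lemma is_family_A_even_iff:
  "is_family_A scale (2 * Suc l) \<F> \<longleftrightarrow>
    (\<exists>U\<in>subspaces_of_dim scale l.
      \<F> = insert U (subspaces_of_dim scale (Suc l) - upper_shadow scale l {U}))"
proof -
  have "family_A scale (2 * Suc l) U =
      insert U (subspaces_of_dim scale (Suc l) - upper_shadow scale l {U})" for U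
    by (auto simp: family_A_def upper_shadow_def)
  then show ?thesis by (simp add: is_family_A_def)
qed

context finite_dimensional_vector_space
begin

lemma mem_subspaces_of_dim: "F \<in> subspaces_of_dim scale k \<longleftrightarrow> subspace F \<and> dim F = k"
  by (simp add: subspaces_of_dim_def)

lemma dim_lower_layer_le:
  assumes "\<F> \<subseteq> all_subspaces scale" "\<forall>F\<in>\<F>. dim F \<le> Suc u" "F \<in> lower_layer scale (Suc u) \<F>"
  shows "dim F \<le> u"
  using assms
  by (force simp: lower_layer_def shadow_def subspaces_of_dim_def all_subspaces_def le_Suc_eq)

lemma dim_raise_layer_ge:
  assumes "\<F> \<subseteq> all_subspaces scale" "\<forall>F\<in>\<F>. l \<le> dim F" "F \<in> raise_layer scale l \<F>"
  shows "Suc l \<le> dim F"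
  using assms
  by (force simp: raise_layer_def upper_shadow_def subspaces_of_dim_def all_subspaces_def Suc_le_eq)

lemma dim_raise_layer_le:
  assumes "\<forall>F\<in>\<F>. dim F \<le> k" "Suc l \<le> k" "F \<in> raise_layer scale l \<F>"
  shows "dim F \<le> k"
  using assms by (auto simp: raise_layer_def upper_shadow_def mem_subspaces_of_dim)

lemma antichain_lower_layer:
  assumes sub: "\<F> \<subseteq> all_subspaces scale" and antichain: "subspace_antichain \<F>"
    and dim: "\<forall>F\<in>\<F>. dim F \<le> Suc u"
  shows "subspace_antichain (lower_layer scale (Suc u) \<F>)"
proof -
  let ?T = "subspaces_of_dim scale (Suc u)"
  let ?S = "shadow scale (Suc u) (\<F> \<inter> ?T)"
  have "X = Y" if "X \<in> \<F> - ?T \<union> ?S" "Y \<in> \<F> - ?T \<union> ?S" "X \<subseteq> Y" for X Y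
  proof (rule antichain_exchange[of "(\<subseteq>)"])
    fix X Y assume X: "X \<in> ?S" and Y: "Y \<in> \<F> - ?T \<union> ?S" and "X \<subseteq> Y"
    have "dim Y \<le> u" "subspace Y"
      using Y dim_lower_layer_le[OF sub dim] lower_layer_subset_all_subspaces[OF sub]
      by (auto simp: lower_layer_def all_subspaces_def)
    then show "X = Y"
      using X \<open>X \<subseteq> Y\<close> by (intro subspace_dim_equal) (auto simp: shadow_def)
  qed (use that subspace_antichainD[OF antichain] in \<open>auto simp: transp_def shadow_def\<close>)
  then show ?thesis
    unfolding subspace_antichain_def lower_layer_def by blast
qed

lemma antichain_raise_layer:
  assumes sub: "\<F> \<subseteq> all_subspaces scale" and antichain: "subspace_antichain \<F>"
    and dim: "\<forall>F\<in>\<F>. l \<le> dim F"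
  shows "subspace_antichain (raise_layer scale l \<F>)"
proof -
  let ?T = "subspaces_of_dim scale l"
  let ?S = "upper_shadow scale l (\<F> \<inter> ?T)"
  have "X = Y" if "X \<in> \<F> - ?T \<union> ?S" "Y \<in> \<F> - ?T \<union> ?S" "Y \<subseteq> X" for X Y
  proof (rule antichain_exchange[of "(\<supseteq>)"])
    fix X Y assume X: "X \<in> ?S" and Y: "Y \<in> \<F> - ?T \<union> ?S" and "Y \<subseteq> X"
    have "Suc l \<le> dim Y" "subspace Y"
      using Y dim_raise_layer_ge[OF sub dim] raise_layer_subset_all_subspaces[OF sub]
      by (auto simp: raise_layer_def all_subspaces_def)
    then show "X = Y"
      using X \<open>Y \<subseteq> X\<close>
      by (intro subspace_dim_equal[symmetric]) (auto simp: upper_shadow_def mem_subspaces_of_dim)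
  qed (use that subspace_antichainD[OF antichain] in \<open>auto simp: transp_def upper_shadow_def\<close>)
  then show ?thesis
    unfolding subspace_antichain_def raise_layer_def by blast
qed

lemma span_subset_iff: "subspace S \<Longrightarrow> span A \<subseteq> S \<longleftrightarrow> A \<subseteq> S"
  using span_superset span_minimal by blast

lemma span_Un_eq_sums:
  assumes "subspace A" "subspace B"
  shows "span (A \<union> B) = {x + y | x y. x \<in> A \<and> y \<in> B}"
  using assms by (simp add: span_Un span_eq_iff[THEN iffD2])

lemma dim_Un_Int:
  assumes "subspace A" "subspace B"
  shows "dim (A \<union> B) + dim (A \<inter> B) = dim A + dim B"
  using dim_sums_Int[OF assms] unfolding span_Un_eq_sums[OF assms, symmetric] by simp

lemma dim_Un_span: "dim (A \<union> span B) = dim (A \<union> B)"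
proof -
  have "span (A \<union> span B) = span (A \<union> B)"
    by (simp add: span_Un span_span)
  then show ?thesis by (metis dim_span)
qed

lemma dim_Un_set_le: "dim (W \<union> set xs) \<le> dim W + length xs"
  by (induction xs) (auto simp: dim_insert)

lemma choose_subspace_between:
  assumes "subspace U" "subspace S" "U \<subseteq> S" "dim U \<le> k" "k \<le> dim S"
  obtains X where "subspace X" "U \<subseteq> X" "X \<subseteq> S" "dim X = k"
proof -
  obtain B where B: "B \<subseteq> U" "independent B" "span B = U" "card B = dim U"
    using basis_subspace_exists[OF assms(1)] by metis
  obtain C where C: "B \<subseteq> C" "C \<subseteq> S" "independent C" "S \<subseteq> span C"
    using maximal_independent_subset_extend[of B S] B assms(3) by auto
  have "card C = dim S"
    using basis_card_eq_dim C by blast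
  then obtain D where D: "B \<subseteq> D" "D \<subseteq> C" "card D = k"
    using exists_subset_between[of B k C] assms(4,5) B(4) C(1) finiteI_independent[OF C(3)] by auto
  show thesis
  proof
    show "U \<subseteq> span D" using B(3) D(1) span_mono by blast
    show "span D \<subseteq> S" using C(2) D(2) assms(2) by (intro span_minimal) auto
    show "dim (span D) = k"
      using C(3) D by (simp add: dim_eq_card_independent independent_mono)
  qed simp
qed

lemma obtain_mem_raise_layer:
  assumes "U \<in> \<F> \<inter> subspaces_of_dim scale l" "l < dim UNIV"
  obtains G where "G \<in> raise_layer scale l \<F>" "dim G = Suc l"
proof -
  obtain G where "subspace G" "U \<subseteq> G" "dim G = Suc l"
    using choose_subspace_between[of U UNIV "Suc l"] assms by (auto simp: mem_subspaces_of_dim)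
  moreover from this have "G \<in> raise_layer scale l \<F>"
    using assms(1) unfolding raise_layer_def upper_shadow_def mem_subspaces_of_dim by blast
  ultimately show thesis using that by blast
qed

lemma common_cover_unique:
  assumes "K \<in> subspaces_of_dim scale l" "U \<in> subspaces_of_dim scale l" "K \<noteq> U"
    and "G \<in> subspaces_of_dim scale (Suc l)" "K \<subseteq> G" "U \<subseteq> G"
  shows "G = span (K \<union> U)"
proof (rule subspace_dim_equal[symmetric])
  have "\<not> U \<subseteq> K"
    using assms(1-3) subspace_dim_equal[of U K] by (auto simp: mem_subspaces_of_dim)
  then have "dim (span K) < dim (span (K \<union> U))"
    using assms(1) span_superset[of "K \<union> U"]
    by (intro dim_psubset) (auto simp: mem_subspaces_of_dim span_eq_iff[THEN iffD2])
  then show "dim G \<le> dim (span (K \<union> U))"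
    using assms by (simp add: mem_subspaces_of_dim)
  show "span (K \<union> U) \<subseteq> G"
    using assms by (intro span_minimal) (auto simp: mem_subspaces_of_dim)
qed (use assms in \<open>auto simp: mem_subspaces_of_dim\<close>)

lemma s_union_iff:
  assumes "\<F> \<subseteq> all_subspaces scale"
  shows "s_union scale s \<F> \<longleftrightarrow> (\<forall>F\<in>\<F>. \<forall>F'\<in>\<F>. dim (F \<union> F') \<le> s)"
proof -
  have "dim {x + y | x y. x \<in> F \<and> y \<in> F'} = dim (F \<union> F')" if "F \<in> \<F>" "F' \<in> \<F>" for F F'
    using that assms by (subst span_Un_eq_sums[symmetric]) (auto simp: all_subspaces_def)
  then show ?thesis by (simp add: s_union_def)
qed

lemma s_union_refines:
  assumes "\<F> \<subseteq> all_subspaces scale" "\<G> \<subseteq> all_subspaces scale"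
    and "s_union scale s \<F>" "refines \<G> \<F>"
  shows "s_union scale s \<G>"
  unfolding s_union_iff[OF assms(2)]
proof (intro ballI)
  fix X Y assume "X \<in> \<G>" "Y \<in> \<G>"
  then obtain X' Y' where "X' \<in> \<F>" "Y' \<in> \<F>" "X \<subseteq> X'" "Y \<subseteq> Y'"
    using assms(4) unfolding refines_def by meson
  then show "dim (X \<union> Y) \<le> s"
    using assms(3)[unfolded s_union_iff[OF assms(1)]] dim_subset[of "X \<union> Y" "X' \<union> Y'"]
    by (meson Un_mono order_trans)
qed

lemma s_union_dim_Int_pos:
  assumes "\<F> \<subseteq> all_subspaces scale" "s_union scale s \<F>" "s \<le> 2 * u + 1"
    and "F \<in> \<F> \<inter> subspaces_of_dim scale (Suc u)" "F' \<in> \<F> \<inter> subspaces_of_dim scale (Suc u)"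
  shows "1 \<le> dim (F \<inter> F')"
proof -
  have "dim (F \<union> F') \<le> s"
    using assms(2,4,5) unfolding s_union_iff[OF assms(1)] by blast
  moreover have "dim (F \<union> F') + dim (F \<inter> F') = 2 * Suc u"
    using assms(4,5) dim_Un_Int[of F F'] by (simp add: mem_subspaces_of_dim)
  ultimately show ?thesis using assms(3) by arith
qed

lemma two_union_antichain_singleton:
  assumes sub: "\<F> \<subseteq> all_subspaces scale" and antichain: "subspace_antichain \<F>"
    and union: "s_union scale 2 \<F>" and not_lines: "\<not> \<F> \<subseteq> subspaces_of_dim scale 1"
  obtains X where "\<F> = {X}"
proof -
  obtain X where X: "X \<in> \<F>" "dim X \<noteq> 1" "subspace X"
    using not_lines sub by (auto simp: subspaces_of_dim_def all_subspaces_def)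
  have "F = X" if F: "F \<in> \<F>" for F
  proof (cases "dim X = 0")
    case True
    have "subspace F" using F sub by (auto simp: all_subspaces_def)
    then have "X \<subseteq> F" using True subspace_0 by auto
    then show ?thesis using subspace_antichainD[OF antichain X(1) F] by simp
  next
    case False
    have "dim (X \<union> F) \<le> 2"
      using union[unfolded s_union_iff[OF sub]] F X by blast
    then have "dim (X \<union> F) \<le> dim X"
      using False X(2) by linarith
    then have "X = span (X \<union> F)"
      using X(3) by (intro subspace_dim_equal) (auto intro: span_base)
    then have "F \<subseteq> X" using span_superset[of "X \<union> F"] by auto
    then show ?thesis using subspace_antichainD[OF antichain F X(1)] by simp
  qed
  then show thesis using X(1) that by blast
qed

lemma not_is_family_B_2_singleton:
  assumes "3 \<le> dim UNIV"
  shows "\<not> is_family_B scale 2 {X}"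
proof
  assume "is_family_B scale 2 {X}"
  then obtain W where W: "subspace W" "dim W = 2" and X: "{X} = family_B scale 2 W"
    by (auto simp: is_family_B_def subspaces_of_dim_def)
  have "W \<noteq> UNIV" using W assms by auto
  then obtain x where x: "x \<notin> W" by auto
  then have "x \<noteq> 0" using subspace_0[OF W(1)] by auto
  moreover have "x \<in> span {x}" by (simp add: span_base)
  ultimately have "span {x} \<in> family_B scale 2 W" "span {x} \<noteq> W" "W \<in> family_B scale 2 W"
    using x by (auto simp: family_B_def subspaces_of_dim_def dim_insert)
  then show False using X by auto
qed

end

section \<open>Counting subspaces over a finite field\<close>

locale finite_field_space = finite_dimensional_vector_space scale Basis
  for scale :: "'a::{field,finite} \<Rightarrow> 'b::ab_group_add \<Rightarrow> 'b" (infixr "*s" 75) and Basis +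
  fixes q n :: nat
  assumes q_eq: "q = CARD('a)" and card_Basis [simp]: "card Basis = n"
begin

lemma q_ge_2: "2 \<le> q"
proof -
  have "card {0, 1 :: 'a} \<le> q"
    unfolding q_eq by (intro card_mono) auto
  then show ?thesis by simp
qed

lemma card_span_independent:
  assumes "finite B" "independent B"
  shows "card (span B) = q ^ card B"
proof -
  let ?comb = "\<lambda>u. \<Sum>v\<in>B. u v *s v"
  have "inj_on ?comb (B \<rightarrow>\<^sub>E UNIV)"
  proof (rule inj_onI)
    fix u w assume uw: "u \<in> B \<rightarrow>\<^sub>E UNIV" "w \<in> B \<rightarrow>\<^sub>E UNIV" "?comb u = ?comb w"
    then have "(\<Sum>v\<in>B. (u v - w v) *s v) = 0"
      by (simp add: scale_left_diff_distrib sum_subtractf)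
    then have "u v = w v" if "v \<in> B" for v
      using independentD[OF assms(2,1) order_refl, of "\<lambda>v. u v - w v"] that by simp
    then show "u = w" using uw by (intro PiE_ext)
  qed
  moreover have "span B = ?comb ` (B \<rightarrow>\<^sub>E UNIV)"
  proof (intro subset_antisym subsetI)
    fix x assume "x \<in> span B"
    then obtain u where "x = ?comb u"
      using span_finite[OF assms(1)] by auto
    then show "x \<in> ?comb ` (B \<rightarrow>\<^sub>E UNIV)"
      by (intro image_eqI[of _ _ "restrict u B"]) auto
  qed (auto intro: span_sum span_scale span_base)
  ultimately show ?thesis
    by (simp add: card_image card_PiE assms(1) q_eq)
qed

lemma card_subspace: "subspace S \<Longrightarrow> card S = q ^ dim S"
  using card_span_independent by (metis basis_subspace_exists)

lemma finite_vectors [simp]: "finite (A :: 'b set)"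
proof -
  have "card (UNIV :: 'b set) \<noteq> 0"
    using card_subspace[OF subspace_UNIV] q_ge_2 by simp
  then show ?thesis by (metis card.infinite finite_subset subset_UNIV)
qed

lemma finite_families [simp]: "finite (\<F> :: 'b set set)"
  by (rule finite_subset[OF _ finite_Pow_iff[THEN iffD2, OF finite_vectors[of UNIV]]]) auto

lemma real_card_Diff_subspace:
  assumes "subspace S" "subspace U" "U \<subseteq> S"
  shows "real (card (S - U)) = real q ^ dim S - real q ^ dim U"
proof -
  have "real (card (S - U)) + real (card U) = real (card S)"
    using card_Diff_add[of S U] assms(3) by (simp flip: of_nat_add)
  then show ?thesis using assms by (simp add: card_subspace)
qed

lemma dim_le_n: "dim S \<le> n"
  using dim_subset_UNIV by (simp add: dimension_def)

definition independent_tuples :: "'b set \<Rightarrow> 'b set \<Rightarrow> nat \<Rightarrow> 'b list set" where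
  "independent_tuples W S k = {xs. length xs = k \<and> set xs \<subseteq> S \<and> dim (W \<union> set xs) = dim W + k}"

definition independent_subspaces :: "'b set \<Rightarrow> 'b set \<Rightarrow> nat \<Rightarrow> 'b set set" where
  "independent_subspaces W S k =
    {K \<in> subspaces_of_dim scale k. K \<subseteq> S \<and> dim (W \<union> K) = dim W + k}"

lemma finite_independent_tuples [simp]: "finite (independent_tuples W S k)"
  by (rule finite_subset[OF _ finite_lists_length_eq[of S k]])
    (auto simp: independent_tuples_def)

lemma independent_tuples_Suc:
  "independent_tuples W S (Suc k) =
    (\<lambda>(xs, x). x # xs) ` (SIGMA xs:independent_tuples W S k. S - span (W \<union> set xs))"
  (is "?L = ?f ` ?R")
proof (intro subset_antisym subsetI)
  fix ys assume ys: "ys \<in> ?L"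
  then obtain x xs where [simp]: "ys = x # xs"
    by (cases ys) (auto simp: independent_tuples_def)
  have "x \<notin> span (W \<union> set xs)" "dim (W \<union> set xs) = dim W + k"
    using ys dim_Un_set_le[of W xs]
    by (auto simp: independent_tuples_def dim_insert split: if_splits)
  then have "(xs, x) \<in> ?R"
    using ys by (auto simp: independent_tuples_def)
  then show "ys \<in> ?f ` ?R" by force
qed (auto simp: independent_tuples_def dim_insert)

lemma card_independent_tuples:
  assumes "subspace S" "W \<subseteq> S"
  shows "real (card (independent_tuples W S k)) = (\<Prod>i<k. real q ^ dim S - real q ^ (dim W + i))"
proof (induction k)
  case 0
  have "independent_tuples W S 0 = {[]}"
    by (auto simp: independent_tuples_def)
  then show ?case by simp
next
  case (Suc k)
  let ?T = "independent_tuples W S k"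
  have "card (independent_tuples W S (Suc k)) = card (SIGMA xs:?T. S - span (W \<union> set xs))"
    unfolding independent_tuples_Suc by (intro card_image) (auto simp: inj_on_def)
  also have "real \<dots> = (\<Sum>xs\<in>?T. real (card (S - span (W \<union> set xs))))"
    by (simp add: card_SigmaI)
  also have "\<dots> = (\<Sum>xs\<in>?T. real q ^ dim S - real q ^ (dim W + k))"
  proof (rule sum.cong[OF refl])
    fix xs assume xs: "xs \<in> ?T"
    then have "span (W \<union> set xs) \<subseteq> S"
      using assms by (intro span_minimal) (auto simp: independent_tuples_def)
    then show "real (card (S - span (W \<union> set xs))) = real q ^ dim S - real q ^ (dim W + k)"
      using xs assms by (simp add: real_card_Diff_subspace independent_tuples_def)
  qed
  finally show ?case using Suc by simp
qed

lemma independent_tuples_span_eq: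
  assumes "K \<in> subspaces_of_dim scale k" "xs \<in> independent_tuples {} K k"
  shows "span (set xs) = K"
  using assms
  by (intro subspace_dim_equal span_minimal)
    (auto simp: independent_tuples_def mem_subspaces_of_dim)

lemma independent_tuples_eq_UN:
  assumes "subspace S"
  shows "independent_tuples W S k = (\<Union>K\<in>independent_subspaces W S k. independent_tuples {} K k)"
proof (intro subset_antisym subsetI)
  fix xs assume xs: "xs \<in> independent_tuples W S k"
  let ?K = "span (set xs)"
  have dim_Un: "dim (W \<union> ?K) = dim W + k"
    using xs by (simp add: dim_Un_span independent_tuples_def)
  have "dim ?K = k"
  proof (rule antisym)
    show "dim ?K \<le> k"
      using xs dim_Un_set_le[of "{}" xs] by (simp add: independent_tuples_def)
    show "k \<le> dim ?K"
      using dim_Un dim_Un_Int[of "span W" ?K] dim_Un_span[of ?K W] by (simp add: Un_commute)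
  qed
  moreover have "?K \<subseteq> S"
    using xs assms by (intro span_minimal) (auto simp: independent_tuples_def)
  moreover have "xs \<in> independent_tuples {} ?K k"
    using xs \<open>dim ?K = k\<close> by (auto simp: independent_tuples_def span_base)
  ultimately show "xs \<in> (\<Union>K\<in>independent_subspaces W S k. independent_tuples {} K k)"
    using dim_Un by (auto simp: independent_subspaces_def mem_subspaces_of_dim)
next
  fix xs assume "xs \<in> (\<Union>K\<in>independent_subspaces W S k. independent_tuples {} K k)"
  then obtain K where K: "K \<in> independent_subspaces W S k" and xs: "xs \<in> independent_tuples {} K k"
    by blast
  then have "span (set xs) = K"
    by (intro independent_tuples_span_eq) (auto simp: independent_subspaces_def)
  then show "xs \<in> independent_tuples W S k"
    using K xs dim_Un_span[of W "set xs"]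
    by (auto simp: independent_subspaces_def independent_tuples_def)
qed

lemma card_independent_subspaces:
  assumes "subspace S" "W \<subseteq> S"
  shows "real (card (independent_subspaces W S k)) =
    (\<Prod>i<k. (real q ^ dim S - real q ^ (dim W + i)) / (real q ^ k - real q ^ i))"
proof -
  let ?D = "independent_subspaces W S k"
  have sub: "?D \<subseteq> subspaces_of_dim scale k"
    by (auto simp: independent_subspaces_def)
  have disjoint: "independent_tuples {} K k \<inter> independent_tuples {} L k = {}"
    if "K \<in> ?D" "L \<in> ?D" "K \<noteq> L" for K L
    using independent_tuples_span_eq[of K k] independent_tuples_span_eq[of L k] that sub by blast
  have "card (independent_tuples W S k) = (\<Sum>K\<in>?D. card (independent_tuples {} K k))"
    unfolding independent_tuples_eq_UN[OF assms(1)]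
    by (intro card_UN_disjoint ballI impI disjoint) simp_all
  then have "real (card (independent_tuples W S k)) =
      (\<Sum>K\<in>?D. real (card (independent_tuples {} K k)))"
    by simp
  also have "\<dots> = (\<Sum>K\<in>?D. \<Prod>i<k. real q ^ k - real q ^ i)"
    using sub by (intro sum.cong) (auto simp: card_independent_tuples mem_subspaces_of_dim)
  finally have "(\<Prod>i<k. real q ^ dim S - real q ^ (dim W + i)) =
      real (card ?D) * (\<Prod>i<k. real q ^ k - real q ^ i)"
    using assms by (simp add: card_independent_tuples)
  moreover have "(\<Prod>i<k. real q ^ k - real q ^ i) \<noteq> 0"
    using q_ge_2 by (auto simp: power_inject_exp)
  ultimately show ?thesis
    by (simp add: prod_dividef)
qed

lemma card_subspaces_of_dim_in:
  assumes "subspace S" "k \<le> dim S"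
  shows "real (card {K \<in> subspaces_of_dim scale k. K \<subseteq> S}) = gauss_binomial q (dim S) k"
proof -
  have "{K \<in> subspaces_of_dim scale k. K \<subseteq> S} = independent_subspaces {} S k"
    by (auto simp: independent_subspaces_def mem_subspaces_of_dim)
  then show ?thesis
    using card_independent_subspaces[of S "{}" k] assms q_ge_2 by (simp add: gauss_binomial_eq)
qed

lemma card_subspaces_of_dim:
  "k \<le> n \<Longrightarrow> real (card (subspaces_of_dim scale k)) = gauss_binomial q n k"
  using card_subspaces_of_dim_in[of UNIV k] by simp

lemma card_hyperplanes:
  assumes "S \<in> subspaces_of_dim scale (Suc l)"
  shows "real (card {K \<in> subspaces_of_dim scale l. K \<subseteq> S}) = gauss_binomial q (Suc l) 1"
  using card_subspaces_of_dim_in[of S l] gauss_binomial_symmetric[OF q_ge_2, of l "Suc l"] assms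
  by (simp add: mem_subspaces_of_dim Suc_diff_le)

lemma card_complements:
  assumes "subspace X" "dim X + d = n"
  shows "card (independent_subspaces X UNIV d) = q ^ (d * dim X)"
proof -
  have "(real q ^ n - real q ^ (dim X + i)) / (real q ^ d - real q ^ i) = real q ^ dim X"
    if "i < d" for i
  proof -
    have "real q ^ i < real q ^ d"
      using that q_ge_2 by (intro power_strict_increasing) auto
    moreover have "real q ^ n - real q ^ (dim X + i) = real q ^ dim X * (real q ^ d - real q ^ i)"
      unfolding assms(2)[symmetric] by (simp add: power_add right_diff_distrib)
    ultimately show ?thesis by simp
  qed
  then have "real (card (independent_subspaces X UNIV d)) = (real q ^ dim X) ^ d"
    using card_independent_subspaces[of UNIV X d] by simp
  also have "\<dots> = real (q ^ (d * dim X))"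
    by (simp add: mult.commute flip: power_mult)
  finally show ?thesis by (simp only: of_nat_eq_iff)
qed

lemma Compl_eq_UN_covers:
  assumes "U \<in> subspaces_of_dim scale l"
  shows "- U = (\<Union>G\<in>upper_shadow scale l {U}. G - U)"
proof (intro subset_antisym subsetI)
  fix v assume v: "v \<in> - U"
  have "span (insert v U) \<in> upper_shadow scale l {U}"
    using v assms
    by (auto simp: upper_shadow_def mem_subspaces_of_dim dim_insert span_eq_iff[THEN iffD2]
        intro: span_base)
  moreover have "v \<in> span (insert v U)"
    by (simp add: span_base)
  ultimately show "v \<in> (\<Union>G\<in>upper_shadow scale l {U}. G - U)"
    using v by blast
qed auto

lemma cover_eq_span_insert:
  assumes "U \<in> subspaces_of_dim scale l" "G \<in> upper_shadow scale l {U}" "v \<in> G - U"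
  shows "G = span (insert v U)"
  using assms
  by (intro subspace_dim_equal[symmetric] span_minimal)
    (auto simp: upper_shadow_def mem_subspaces_of_dim dim_insert span_eq_iff[THEN iffD2])

lemma card_covers:
  assumes "U \<in> subspaces_of_dim scale l"
  shows "real (card (upper_shadow scale l {U})) = gauss_binomial q (n - l) 1"
proof -
  let ?C = "upper_shadow scale l {U}"
  have U: "subspace U" "dim U = l" "l \<le> n"
    using assms dim_le_n[of U] by (auto simp: mem_subspaces_of_dim)
  have disjoint: "(G - U) \<inter> (G' - U) = {}" if "G \<in> ?C" "G' \<in> ?C" "G \<noteq> G'" for G G'
    using cover_eq_span_insert[OF assms that(1)] cover_eq_span_insert[OF assms that(2)] that(3)
    by blast
  have "card (- U) = (\<Sum>G\<in>?C. card (G - U))"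
    unfolding Compl_eq_UN_covers[OF assms]
    by (intro card_UN_disjoint ballI impI disjoint) simp_all
  then have "real (card (UNIV - U)) = (\<Sum>G\<in>?C. real (card (G - U)))"
    by (simp add: Compl_eq_Diff_UNIV)
  also have "\<dots> = (\<Sum>G\<in>?C. real q ^ Suc l - real q ^ l)"
    using U by (intro sum.cong)
      (auto simp: real_card_Diff_subspace upper_shadow_def mem_subspaces_of_dim)
  finally have "real (card ?C) * (real q ^ Suc l - real q ^ l) = real q ^ n - real q ^ l"
    using U by (simp add: real_card_Diff_subspace)
  moreover have "real q ^ n = real q ^ l * real q ^ (n - l)"
    using U by (simp flip: power_add)
  ultimately have "real (card ?C) * (real q - 1) * real q ^ l = (real q ^ (n - l) - 1) * real q ^ l"
    by (simp add: algebra_simps)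
  then have "real (card ?C) * (real q - 1) = real q ^ (n - l) - 1"
    using q_ge_2 by simp
  then show ?thesis
    unfolding gauss_binomial_1 using q_ge_2 by (simp add: field_simps)
qed

section \<open>Shadows of intersecting families\<close>

text \<open>Descends from \<open>I + \<langle>v\<rangle>\<close> to \<open>I\<close>, summing over all vectors \<open>v \<notin> I\<close>.\<close>

lemma sum_superspaces_eq_0:
  fixes x :: "'b set \<Rightarrow> real"
  assumes \<H>: "\<H> \<subseteq> subspaces_of_dim scale k"
    and zero: "\<And>D. D \<in> subspaces_of_dim scale j \<Longrightarrow> (\<Sum>F | F \<in> \<H> \<and> D \<subseteq> F. x F) = 0"
    and "j \<le> k" "subspace I" "dim I + i = j"
  shows "(\<Sum>F | F \<in> \<H> \<and> I \<subseteq> F. x F) = 0"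
  using assms(4,5)
proof (induction i arbitrary: I)
  case 0
  then show ?case using zero by (simp add: mem_subspaces_of_dim)
next
  case (Suc i)
  let ?A = "{F \<in> \<H>. I \<subseteq> F}"
  have "(\<Sum>F\<in>?A. x F) * (real q ^ k - real q ^ dim I) = (\<Sum>F\<in>?A. \<Sum>v | v \<in> - I \<and> v \<in> F. x F)"
    unfolding sum_distrib_right
  proof (rule sum.cong[OF refl])
    fix F assume "F \<in> ?A"
    moreover have "{v. v \<in> - I \<and> v \<in> F} = F - I" by auto
    ultimately show "x F * (real q ^ k - real q ^ dim I) = (\<Sum>v | v \<in> - I \<and> v \<in> F. x F)"
      using \<H> Suc.prems by (auto simp: real_card_Diff_subspace mem_subspaces_of_dim)
  qed
  also have "\<dots> = (\<Sum>v\<in>- I. \<Sum>F | F \<in> ?A \<and> v \<in> F. x F)"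
    by (rule sum.swap_restrict) auto
  also have "\<dots> = 0"
  proof (rule sum.neutral, rule ballI)
    fix v assume v: "v \<in> - I"
    let ?J = "span (insert v I)"
    have "?J \<subseteq> F \<longleftrightarrow> I \<subseteq> F \<and> v \<in> F" if "F \<in> \<H>" for F
      using that \<H> by (subst span_subset_iff) (auto simp: mem_subspaces_of_dim)
    then have "{F. F \<in> ?A \<and> v \<in> F} = {F. F \<in> \<H> \<and> ?J \<subseteq> F}"
      by blast
    moreover have "dim ?J + i = j"
      using v Suc.prems by (simp add: dim_insert span_eq_iff[THEN iffD2])
    ultimately show "(\<Sum>F | F \<in> ?A \<and> v \<in> F. x F) = 0"
      using Suc.IH[of ?J] by simp
  qed
  finally show ?case
    using Suc.prems \<open>j \<le> k\<close> q_ge_2 by (auto simp: power_inject_exp)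
qed

text \<open>\<open>|F \<inter> E|^r\<close> counts the \<open>r\<close>-tuples in \<open>E\<close> that lie in \<open>F\<close>; each spans a space of
  dimension at most \<open>r\<close>.\<close>

lemma sum_card_Int_power_eq_0:
  fixes x :: "'b set \<Rightarrow> real"
  assumes \<H>: "\<H> \<subseteq> subspaces_of_dim scale k"
    and zero: "\<And>D. D \<in> subspaces_of_dim scale j \<Longrightarrow> (\<Sum>F | F \<in> \<H> \<and> D \<subseteq> F. x F) = 0"
    and "j \<le> k" "r \<le> j"
  shows "(\<Sum>F\<in>\<H>. x F * real (card (F \<inter> E)) ^ r) = 0"
proof -
  let ?L = "{vs. set vs \<subseteq> E \<and> length vs = r}"
  have "(\<Sum>F\<in>\<H>. x F * real (card (F \<inter> E)) ^ r) = (\<Sum>F\<in>\<H>. \<Sum>vs | vs \<in> ?L \<and> set vs \<subseteq> F. x F)"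
  proof (rule sum.cong[OF refl])
    fix F
    have "{vs. vs \<in> ?L \<and> set vs \<subseteq> F} = {vs. set vs \<subseteq> F \<inter> E \<and> length vs = r}"
      by auto
    then have "card {vs. vs \<in> ?L \<and> set vs \<subseteq> F} = card (F \<inter> E) ^ r"
      by (simp only: card_lists_length_eq finite_vectors)
    then show "x F * real (card (F \<inter> E)) ^ r = (\<Sum>vs | vs \<in> ?L \<and> set vs \<subseteq> F. x F)"
      by simp
  qed
  also have "\<dots> = (\<Sum>vs\<in>?L. \<Sum>F | F \<in> \<H> \<and> set vs \<subseteq> F. x F)"
    by (rule sum.swap_restrict) (auto simp: finite_lists_length_eq)
  also have "\<dots> = 0"
  proof (rule sum.neutral, rule ballI)
    fix vs assume vs: "vs \<in> ?L"
    let ?J = "span (set vs)"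
    have "set vs \<subseteq> F \<longleftrightarrow> ?J \<subseteq> F" if "F \<in> \<H>" for F
      using that \<H> by (subst span_subset_iff) (auto simp: mem_subspaces_of_dim)
    then have "{F. F \<in> \<H> \<and> set vs \<subseteq> F} = {F. F \<in> \<H> \<and> ?J \<subseteq> F}"
      by blast
    moreover have "dim ?J \<le> j"
      using dim_Un_set_le[of "{}" vs] vs \<open>r \<le> j\<close> by simp
    ultimately show "(\<Sum>F | F \<in> \<H> \<and> set vs \<subseteq> F. x F) = 0"
      using sum_superspaces_eq_0[OF \<H> zero \<open>j \<le> k\<close>, of ?J "j - dim ?J"] by simp
  qed
  finally show ?thesis .
qed

lemma dim_Int_less:
  assumes "E \<in> subspaces_of_dim scale k" "F \<in> subspaces_of_dim scale k" "E \<noteq> F"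
  shows "dim (E \<inter> F) < k"
proof (rule ccontr)
  assume "\<not> dim (E \<inter> F) < k"
  then have "E \<inter> F = E" "E \<inter> F = F"
    using assms by (intro subspace_dim_equal; auto simp: mem_subspaces_of_dim subspace_inter)+
  then show False using assms(3) by auto
qed

text \<open>The incidence matrix of \<open>\<H>\<close> against the \<open>j\<close>-dimensional subspaces has full row rank: a vector
  \<open>x\<close> in its left kernel annihilates every polynomial of degree at most \<open>j\<close> in \<open>|F \<inter> E|\<close>. The one
  with roots \<open>q^(k-j), \<dots>, q^(k-1)\<close> isolates \<open>F = E\<close>.\<close>

lemma sum_superspaces_eq_0_imp_eq_0:
  fixes x :: "'b set \<Rightarrow> real"
  assumes \<H>: "\<H> \<subseteq> subspaces_of_dim scale k"
    and zero: "\<And>D. D \<in> subspaces_of_dim scale j \<Longrightarrow> (\<Sum>F | F \<in> \<H> \<and> D \<subseteq> F. x F) = 0"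
    and "j \<le> k"
    and intersecting: "\<And>F F'. F \<in> \<H> \<Longrightarrow> F' \<in> \<H> \<Longrightarrow> k - j \<le> dim (F \<inter> F')"
    and E: "E \<in> \<H>"
  shows "x E = 0"
proof -
  define p where "p = (\<Prod>i\<in>{k - j..<k}. [:- (real q ^ i), 1:])"
  have "degree p \<le> j"
    unfolding p_def using \<open>j \<le> k\<close>
    by (intro order_trans[OF degree_prod_sum_le]) (auto simp: o_def)
  then have "(\<Sum>F\<in>\<H>. x F * poly p (real (card (F \<inter> E)))) = 0"
    using sum_card_Int_power_eq_0[OF \<H> zero \<open>j \<le> k\<close>] by (intro sum_mult_poly_eq_0) auto
  moreover have p_eq_0_iff:
    "poly p (real (card (F \<inter> E))) = 0 \<longleftrightarrow> dim (F \<inter> E) < k" if "F \<in> \<H>" for F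
  proof -
    have "card (F \<inter> E) = q ^ dim (F \<inter> E)"
      using that E \<H> by (auto intro!: card_subspace subspace_inter simp: mem_subspaces_of_dim)
    then show ?thesis
      using intersecting[OF that E] q_ge_2 by (auto simp: p_def poly_prod power_inject_exp)
  qed
  then have "poly p (real (card (F \<inter> E))) = 0" if "F \<in> \<H> - {E}" for F
    using that E \<H> by (auto intro!: dim_Int_less)
  then have "(\<Sum>F\<in>\<H> - {E}. x F * poly p (real (card (F \<inter> E)))) = 0"
    by (intro sum.neutral) auto
  ultimately have "x E * poly p (real (card (E \<inter> E))) = 0"
    using E by (simp add: sum.remove[of \<H> E])
  moreover have "dim E = k"
    using E \<H> by (auto simp: mem_subspaces_of_dim)
  ultimately show ?thesis
    using p_eq_0_iff[OF E] by simp
qed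

theorem card_le_card_subspaces_below:
  assumes \<H>: "\<H> \<subseteq> subspaces_of_dim scale k" and "j \<le> k"
    and intersecting: "\<And>F F'. F \<in> \<H> \<Longrightarrow> F' \<in> \<H> \<Longrightarrow> k - j \<le> dim (F \<inter> F')"
  shows "card \<H> \<le> card {D \<in> subspaces_of_dim scale j. \<exists>H\<in>\<H>. D \<subseteq> H}"
proof (rule ccontr)
  let ?S = "{D \<in> subspaces_of_dim scale j. \<exists>H\<in>\<H>. D \<subseteq> H}"
  assume "\<not> ?thesis"
  then obtain x :: "'b set \<Rightarrow> real" where x: "\<exists>F\<in>\<H>. x F \<noteq> 0"
    and kernel: "\<forall>D\<in>?S. (\<Sum>F\<in>\<H>. of_bool (D \<subseteq> F) * x F) = 0"
    using underdetermined_system_nontrivial_solution[of ?S \<H> "\<lambda>D F. of_bool (D \<subseteq> F)"]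
    by (auto simp: not_le)
  have "(\<Sum>F | F \<in> \<H> \<and> D \<subseteq> F. x F) = 0" if D: "D \<in> subspaces_of_dim scale j" for D
  proof (cases "D \<in> ?S")
    case True
    have "(\<Sum>F\<in>\<H>. of_bool (D \<subseteq> F) * x F) = (\<Sum>F | F \<in> \<H> \<and> D \<subseteq> F. x F)"
      by (rule sum.mono_neutral_cong_right) auto
    then show ?thesis using kernel True by simp
  next
    case False
    then have "{F. F \<in> \<H> \<and> D \<subseteq> F} = {}" using D by auto
    then show ?thesis by (simp only: sum.empty)
  qed
  then show False
    using x sum_superspaces_eq_0_imp_eq_0[OF \<H> _ \<open>j \<le> k\<close> intersecting] by blast
qed

corollary card_le_card_shadow:
  assumes "\<F> \<subseteq> all_subspaces scale" "s_union scale s \<F>" "s \<le> 2 * u + 1"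
  shows "card (\<F> \<inter> subspaces_of_dim scale (Suc u)) \<le>
    card (shadow scale (Suc u) (\<F> \<inter> subspaces_of_dim scale (Suc u)))"
proof -
  let ?T = "\<F> \<inter> subspaces_of_dim scale (Suc u)"
  have "shadow scale (Suc u) ?T = {D \<in> subspaces_of_dim scale u. \<exists>H\<in>?T. D \<subseteq> H}"
    by (auto simp: shadow_def mem_subspaces_of_dim)
  then show ?thesis
    using card_le_card_subspaces_below[of ?T "Suc u" u] s_union_dim_Int_pos[OF assms] by auto
qed

section \<open>Upper shadows\<close>

lemma card_covers_outside_ge:
  assumes "K \<in> subspaces_of_dim scale l" "U \<in> subspaces_of_dim scale l" "K \<noteq> U"
  shows "gauss_binomial q (n - l) 1 - 1 \<le>
    real (card (upper_shadow scale l {K} - upper_shadow scale l {U}))"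
proof -
  let ?K = "upper_shadow scale l {K}" and ?U = "upper_shadow scale l {U}"
  have "?K \<inter> ?U \<subseteq> {span (K \<union> U)}"
    using common_cover_unique[OF assms] by (auto simp: upper_shadow_def)
  then have "card (?K \<inter> ?U) \<le> 1"
    using card_mono[of "{span (K \<union> U)}" "?K \<inter> ?U"] by simp
  then have "card ?K \<le> card (?K - ?U) + 1"
    using card_Int_Diff[of ?K ?U] by simp
  then show ?thesis
    using card_covers[OF assms(1)] by linarith
qed

text \<open>Every other subspace shares at most one cover with \<open>U\<close>, so double counting outside the upper
  shadow of \<open>U\<close> still gains on \<open>\<K>\<close>.\<close>

lemma card_less_card_covers_outside:
  assumes \<K>: "\<K> \<subseteq> subspaces_of_dim scale l" "\<K> \<noteq> {}"
    and U: "U \<in> subspaces_of_dim scale l" "U \<notin> \<K>" and l: "2 * l + 3 \<le> n"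
  shows "card \<K> < card (upper_shadow scale l \<K> - upper_shadow scale l {U})"
proof (rule card_less_by_double_counting)
  let ?E = "upper_shadow scale l \<K> - upper_shadow scale l {U}"
  show "gauss_binomial q (n - l) 1 - 1 \<le> real (card {G \<in> ?E. K \<subseteq> G})" if K: "K \<in> \<K>" for K
  proof -
    have "upper_shadow scale l {K} - upper_shadow scale l {U} \<subseteq> {G \<in> ?E. K \<subseteq> G}"
      using K by (auto simp: upper_shadow_def)
    then have "card (upper_shadow scale l {K} - upper_shadow scale l {U}) \<le> card {G \<in> ?E. K \<subseteq> G}"
      by (intro card_mono) auto
    moreover have "K \<in> subspaces_of_dim scale l" "K \<noteq> U"
      using K \<K> U by auto
    ultimately show ?thesis
      using card_covers_outside_ge[of K l U] U by linarith
  qed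
  show "real (card {K \<in> \<K>. K \<subseteq> G}) \<le> gauss_binomial q (Suc l) 1" if G: "G \<in> ?E" for G
  proof -
    have "card {K \<in> \<K>. K \<subseteq> G} \<le> card {K \<in> subspaces_of_dim scale l. K \<subseteq> G}"
      using \<K> by (intro card_mono) auto
    moreover have "G \<in> subspaces_of_dim scale (Suc l)"
      using G by (simp add: upper_shadow_def)
    ultimately show ?thesis using card_hyperplanes by fastforce
  qed
  show "gauss_binomial q (Suc l) 1 < gauss_binomial q (n - l) 1 - 1"
  proof -
    have "n - l = Suc (n - Suc l)"
      using l by simp
    moreover have "gauss_binomial q (Suc l) 1 < gauss_binomial q (n - Suc l) 1"
      using l q_ge_2 by (intro gauss_binomial_1_less) auto
    moreover have "gauss_binomial q (n - Suc l) 1 \<le> real q * gauss_binomial q (n - Suc l) 1"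
      using q_ge_2 gauss_binomial_1_nonneg[OF q_ge_2, of "n - Suc l"]
        mult_right_mono[of 1 "real q" "gauss_binomial q (n - Suc l) 1"] by simp
    ultimately show ?thesis
      using gauss_binomial_Suc_1[OF q_ge_2, of "n - Suc l"] by simp
  qed
qed (use \<K> gauss_binomial_1_nonneg[OF q_ge_2] in auto)

theorem card_upper_shadow_ge:
  assumes \<H>: "\<H> \<subseteq> subspaces_of_dim scale l" "U \<in> \<H>" and l: "2 * l + 3 \<le> n"
  shows "real (card \<H>) + gauss_binomial q (n - l) 1 - 1 \<le> real (card (upper_shadow scale l \<H>))"
    and "real (card \<H>) + gauss_binomial q (n - l) 1 - 1 = real (card (upper_shadow scale l \<H>)) \<Longrightarrow>
      \<H> = {U}"
proof -
  let ?E = "upper_shadow scale l \<H> - upper_shadow scale l {U}"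
  have "card (upper_shadow scale l \<H>) = card ?E + card (upper_shadow scale l {U})"
    using upper_shadow_mono[of "{U}" \<H> scale l] \<H>(2) by (simp add: card_Diff_add)
  then have card_upper:
    "real (card (upper_shadow scale l \<H>)) = real (card ?E) + gauss_binomial q (n - l) 1"
    using card_covers[of U l] \<H> by auto
  have card_\<H>: "card \<H> = card (\<H> - {U}) + 1"
    using card_Diff_add[of \<H> "{U}"] \<H>(2) by simp
  have less: "card (\<H> - {U}) < card ?E" if "\<H> \<noteq> {U}"
  proof -
    have "card (\<H> - {U}) < card (upper_shadow scale l (\<H> - {U}) - upper_shadow scale l {U})"
      using that \<H> l by (intro card_less_card_covers_outside) auto
    also have "\<dots> \<le> card ?E"
      by (intro card_mono Diff_mono upper_shadow_mono) auto
    finally show ?thesis .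
  qed
  show "real (card \<H>) + gauss_binomial q (n - l) 1 - 1 \<le> real (card (upper_shadow scale l \<H>))"
    using less card_upper card_\<H> by (cases "\<H> = {U}") auto
  show "\<H> = {U}"
    if "real (card \<H>) + gauss_binomial q (n - l) 1 - 1 = real (card (upper_shadow scale l \<H>))"
    using that less card_upper card_\<H> by (cases "\<H> = {U}") auto
qed

section \<open>Moving antichains to the middle layer\<close>

lemma card_le_card_lower_layer:
  assumes "\<F> \<subseteq> all_subspaces scale" "subspace_antichain \<F>" "s_union scale s \<F>" "s \<le> 2 * u + 1"
  shows "card \<F> \<le> card (lower_layer scale (Suc u) \<F>)"
proof -
  let ?T = "subspaces_of_dim scale (Suc u)"
  have "card (lower_layer scale (Suc u) \<F>) =
      card (\<F> - ?T) + card (shadow scale (Suc u) (\<F> \<inter> ?T))"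
    unfolding lower_layer_def using antichain_Int_shadow[OF assms(2), of scale "Suc u"]
    by (intro card_Un_disjoint) auto
  then show ?thesis
    using card_le_card_shadow[OF assms(1,3,4)] card_Int_Diff[of \<F> ?T] by simp
qed

lemma card_less_card_raise_layer:
  assumes "subspace_antichain \<F>" "U \<in> \<F> \<inter> subspaces_of_dim scale l" "2 * l + 3 \<le> n"
  shows "card \<F> < card (raise_layer scale l \<F>)"
proof -
  let ?T = "subspaces_of_dim scale l"
  have "card (raise_layer scale l \<F>) = card (\<F> - ?T) + card (upper_shadow scale l (\<F> \<inter> ?T))"
    unfolding raise_layer_def using antichain_Int_upper_shadow[OF assms(1), of scale l]
    by (intro card_Un_disjoint) auto
  moreover have "1 < gauss_binomial q (n - l) 1"
    using assms(3) q_ge_2 by (intro gauss_binomial_1_gt_1) auto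
  then have "card (\<F> \<inter> ?T) < card (upper_shadow scale l (\<F> \<inter> ?T))"
    using card_upper_shadow_ge(1)[of "\<F> \<inter> ?T" l U] assms(2,3) by simp
  ultimately show ?thesis
    using card_Int_Diff[of \<F> ?T] by simp
qed

lemma exists_low_antichain:
  assumes "\<F> \<subseteq> all_subspaces scale" "subspace_antichain \<F>" "s_union scale s \<F>"
    and s: "s \<le> 2 * d + 1" and "\<forall>F\<in>\<F>. dim F \<le> d + k"
  shows "\<exists>\<G> \<subseteq> all_subspaces scale. subspace_antichain \<G> \<and> (\<forall>G\<in>\<G>. dim G \<le> d) \<and>
    card \<F> \<le> card \<G> \<and> refines \<G> \<F> \<and> {F \<in> \<F>. dim F < d} \<subseteq> \<G>"
  using assms(1,2,3,5)
proof (induction k arbitrary: \<F>)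
  case 0
  then show ?case by (intro exI[of _ \<F>]) (auto simp: refines_refl)
next
  case (Suc k)
  note sub = Suc.prems(1)
  define \<K> where "\<K> = lower_layer scale (Suc (d + k)) \<F>"
  have dim: "\<forall>F\<in>\<F>. dim F \<le> Suc (d + k)"
    using Suc.prems(4) by simp
  have sub_\<K>: "\<K> \<subseteq> all_subspaces scale" and refines_\<K>: "refines \<K> \<F>"
    unfolding \<K>_def using lower_layer_subset_all_subspaces[OF sub] refines_lower_layer by auto
  have "subspace_antichain \<K>" "\<forall>F\<in>\<K>. dim F \<le> d + k"
    unfolding \<K>_def
    using antichain_lower_layer[OF sub Suc.prems(2) dim] dim_lower_layer_le[OF sub dim] by auto
  moreover have "s_union scale s \<K>"
    using s_union_refines[OF sub sub_\<K> Suc.prems(3) refines_\<K>] .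
  ultimately obtain \<G> where \<G>: "\<G> \<subseteq> all_subspaces scale" "subspace_antichain \<G>"
      "\<forall>G\<in>\<G>. dim G \<le> d" "card \<K> \<le> card \<G>" "refines \<G> \<K>" "{F \<in> \<K>. dim F < d} \<subseteq> \<G>"
    using Suc.IH[OF sub_\<K>] by blast
  have "card \<F> \<le> card \<K>"
    unfolding \<K>_def using s by (intro card_le_card_lower_layer[OF Suc.prems(1-3)]) simp
  moreover have "{F \<in> \<F>. dim F < d} \<subseteq> {F \<in> \<K>. dim F < d}"
    by (auto simp: \<K>_def lower_layer_def mem_subspaces_of_dim)
  ultimately show ?case
    using \<G> refines_trans[OF \<G>(5) refines_\<K>] by (intro exI[of _ \<G>]) auto
qed

lemma obtain_low_antichain:
  assumes "\<F> \<subseteq> all_subspaces scale" "subspace_antichain \<F>" "s_union scale s \<F>" "s \<le> 2 * d + 1"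
  obtains \<G> where "\<G> \<subseteq> all_subspaces scale" "subspace_antichain \<G>" "\<forall>G\<in>\<G>. dim G \<le> d"
    "card \<F> \<le> card \<G>" "refines \<G> \<F>" "{F \<in> \<F>. dim F < d} \<subseteq> \<G>"
  using exists_low_antichain[OF assms, of n] dim_le_n by (auto simp: trans_le_add2)

abbreviation family_A_size :: "nat \<Rightarrow> real" where
  "family_A_size d \<equiv> gauss_binomial q n d - real q * gauss_binomial q (n - d) 1"

lemma family_A_size_Suc:
  "Suc l \<le> n \<Longrightarrow>
    family_A_size (Suc l) = gauss_binomial q n (Suc l) - gauss_binomial q (n - l) 1 + 1"
  using gauss_binomial_Suc_1[OF q_ge_2, of "n - Suc l"] by (simp add: Suc_diff_Suc)

lemma card_family_A:
  assumes "is_family_A scale (2 * Suc l) \<F>" "Suc l \<le> n"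
  shows "real (card \<F>) = family_A_size (Suc l)"
proof -
  obtain U where U: "U \<in> subspaces_of_dim scale l"
    and \<F>: "\<F> = insert U (subspaces_of_dim scale (Suc l) - upper_shadow scale l {U})"
    using assms(1) unfolding is_family_A_even_iff by blast
  have "U \<notin> subspaces_of_dim scale (Suc l)"
    using U by (simp add: mem_subspaces_of_dim)
  then have "card \<F> + card (upper_shadow scale l {U}) = card (subspaces_of_dim scale (Suc l)) + 1"
    using card_Diff_add[of "subspaces_of_dim scale (Suc l)" "upper_shadow scale l {U}"]
      upper_shadow_subset_subspaces_of_dim[of scale l "{U}"] by (simp add: \<F>)
  then show ?thesis
    using card_covers[OF U] card_subspaces_of_dim[OF assms(2)] family_A_size_Suc[OF assms(2)]
    by simp
qed

lemma two_layer_antichain_bound: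
  assumes layers: "\<F> \<subseteq> subspaces_of_dim scale l \<union> subspaces_of_dim scale (Suc l)"
    and antichain: "subspace_antichain \<F>" and U: "U \<in> \<F> \<inter> subspaces_of_dim scale l"
    and l: "2 * l + 3 \<le> n"
  shows "real (card \<F>) \<le> family_A_size (Suc l)"
    and "real (card \<F>) = family_A_size (Suc l) \<Longrightarrow> is_family_A scale (2 * Suc l) \<F>"
proof -
  let ?T = "\<F> \<inter> subspaces_of_dim scale l"
  let ?R = "subspaces_of_dim scale (Suc l) - upper_shadow scale l ?T"
  have rest: "\<F> - subspaces_of_dim scale l \<subseteq> ?R"
    using layers antichain_Int_upper_shadow[OF antichain] by blast
  then have card_rest: "card (\<F> - subspaces_of_dim scale l) \<le> card ?R"
    by (intro card_mono) auto
  have card_\<F>: "card \<F> = card ?T + card (\<F> - subspaces_of_dim scale l)"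
    by (rule card_Int_Diff) simp
  have "card ?R + card (upper_shadow scale l ?T) = card (subspaces_of_dim scale (Suc l))"
    using upper_shadow_subset_subspaces_of_dim by (intro card_Diff_add) auto
  then have card_R: "real (card ?R) + real (card (upper_shadow scale l ?T)) =
      gauss_binomial q n (Suc l)"
    using card_subspaces_of_dim[of "Suc l"] l by simp
  have upper: "real (card ?T) + gauss_binomial q (n - l) 1 - 1 \<le>
      real (card (upper_shadow scale l ?T))"
    using U l by (intro card_upper_shadow_ge(1)) auto
  have size: "family_A_size (Suc l) = gauss_binomial q n (Suc l) - gauss_binomial q (n - l) 1 + 1"
    using l by (intro family_A_size_Suc) simp
  show "real (card \<F>) \<le> family_A_size (Suc l)"
    using card_\<F> card_rest card_R upper size by linarith
  assume eq: "real (card \<F>) = family_A_size (Suc l)"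
  have upper_eq: "real (card ?T) + gauss_binomial q (n - l) 1 - 1 =
      real (card (upper_shadow scale l ?T))"
    and rest_eq: "card (\<F> - subspaces_of_dim scale l) = card ?R"
    using card_\<F> card_rest card_R upper size eq by linarith+
  have "?T = {U}"
    using card_upper_shadow_ge(2)[OF _ U l upper_eq] by simp
  moreover have "\<F> - subspaces_of_dim scale l = ?R"
    using rest rest_eq by (simp add: card_subset_eq)
  moreover have "\<F> = ?T \<union> (\<F> - subspaces_of_dim scale l)"
    by blast
  ultimately have "\<F> = insert U (subspaces_of_dim scale (Suc l) - upper_shadow scale l {U})"
    by simp
  then show "is_family_A scale (2 * Suc l) \<F>"
    unfolding is_family_A_even_iff using U by blast
qed

lemma antichain_between_layers_bound:
  assumes "\<F> \<subseteq> all_subspaces scale" "subspace_antichain \<F>"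
    and "\<forall>F\<in>\<F>. dim F \<le> Suc l" "\<exists>F\<in>\<F>. dim F \<le> l" "\<forall>F\<in>\<F>. l \<le> dim F + k" and n: "2 * l + 3 \<le> n"
  shows "real (card \<F>) \<le> family_A_size (Suc l) \<and>
    (real (card \<F>) = family_A_size (Suc l) \<longrightarrow> is_family_A scale (2 * Suc l) \<F>)"
  using assms(1-5)
proof (induction k arbitrary: \<F>)
  case 0
  then obtain U where "U \<in> \<F> \<inter> subspaces_of_dim scale l"
    by (force simp: all_subspaces_def mem_subspaces_of_dim)
  moreover have "\<F> \<subseteq> subspaces_of_dim scale l \<union> subspaces_of_dim scale (Suc l)"
    using "0.prems" by (force simp: all_subspaces_def mem_subspaces_of_dim le_Suc_eq)
  ultimately show ?case
    using two_layer_antichain_bound[OF _ "0.prems"(2) _ n] by blast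
next
  case (Suc k)
  note sub = Suc.prems(1)
  show ?case
  proof (cases "\<exists>U\<in>\<F>. dim U + Suc k = l")
    case False
    then have "\<forall>F\<in>\<F>. l \<le> dim F + k"
      using Suc.prems(5) by force
    then show ?thesis using Suc.IH Suc.prems(1-4) by blast
  next
    case True
    then obtain m where m: "m + Suc k = l" and "\<exists>U\<in>\<F>. dim U = m" by blast
    then obtain U where U: "U \<in> \<F> \<inter> subspaces_of_dim scale m"
      using sub by (auto simp: all_subspaces_def mem_subspaces_of_dim)
    let ?\<G> = "raise_layer scale m \<F>"
    have ge_m: "\<forall>F\<in>\<F>. m \<le> dim F"
      using Suc.prems(5) m by force
    obtain G where "G \<in> ?\<G>" "dim G = Suc m"
      using obtain_mem_raise_layer[OF U] m n by auto
    then have "\<exists>G\<in>?\<G>. dim G \<le> l"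
      using m by force
    moreover have "\<forall>G\<in>?\<G>. dim G \<le> Suc l"
      using dim_raise_layer_le[OF Suc.prems(3), of m] m by simp
    moreover have "\<forall>G\<in>?\<G>. l \<le> dim G + k"
      using dim_raise_layer_ge[OF sub ge_m] m by force
    ultimately have "real (card ?\<G>) \<le> family_A_size (Suc l)"
      using Suc.IH[OF raise_layer_subset_all_subspaces[OF sub]
          antichain_raise_layer[OF sub Suc.prems(2) ge_m]] by blast
    moreover have "card \<F> < card ?\<G>"
      using card_less_card_raise_layer[OF Suc.prems(2) U] m n by simp
    ultimately show ?thesis by linarith
  qed
qed

lemma low_antichain_bound:
  assumes "\<G> \<subseteq> all_subspaces scale" "subspace_antichain \<G>" "\<forall>G\<in>\<G>. dim G \<le> Suc l"
    and "\<not> \<G> \<subseteq> subspaces_of_dim scale (Suc l)" "2 * l + 3 \<le> n"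
  shows "real (card \<G>) \<le> family_A_size (Suc l)"
    and "real (card \<G>) = family_A_size (Suc l) \<Longrightarrow> is_family_A scale (2 * Suc l) \<G>"
proof -
  have "\<exists>G\<in>\<G>. dim G \<le> l"
    using assms(1,3,4) by (force simp: all_subspaces_def mem_subspaces_of_dim le_Suc_eq)
  then show "real (card \<G>) \<le> family_A_size (Suc l)"
    and "real (card \<G>) = family_A_size (Suc l) \<Longrightarrow> is_family_A scale (2 * Suc l) \<G>"
    using antichain_between_layers_bound[OF assms(1-3) _ _ assms(5), of l] by auto
qed

lemma low_antichain_card_less:
  assumes \<G>: "\<G> \<subseteq> all_subspaces scale" "subspace_antichain \<G>" "\<forall>G\<in>\<G>. dim G \<le> Suc l"
    and neq: "\<G> \<noteq> subspaces_of_dim scale (Suc l)" and l: "2 * l + 3 \<le> n"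
  shows "real (card \<G>) < gauss_binomial q n (Suc l)"
proof (cases "\<G> \<subseteq> subspaces_of_dim scale (Suc l)")
  case True
  then have "card \<G> < card (subspaces_of_dim scale (Suc l))"
    using neq by (intro psubset_card_mono) auto
  then show ?thesis using card_subspaces_of_dim[of "Suc l"] l by simp
next
  case False
  have "1 < gauss_binomial q (n - l) 1"
    using l q_ge_2 by (intro gauss_binomial_1_gt_1) auto
  then show ?thesis
    using low_antichain_bound(1)[OF \<G> False l] family_A_size_Suc[of l] l by simp
qed

section \<open>Members above the middle layer\<close>

lemma card_large_joins_ge:
  assumes W: "subspace W" "s < dim W + d" and "d \<le> s" "s < n"
  shows "q ^ (d * (n - d)) \<le> card {G \<in> subspaces_of_dim scale d. s < dim (G \<union> W)}"
proof -
  define c where "c = s - d + 1"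
  have c: "c \<le> dim W" "c \<le> n - d" "s < c + d" "d \<le> n"
    using assms by (auto simp: c_def)
  obtain W' where W': "subspace W'" "W' \<subseteq> W" "dim W' = c"
    using choose_subspace_between[of "{0}" W c] W c by (auto simp: subspace_0)
  obtain X where X: "subspace X" "W' \<subseteq> X" "dim X = n - d"
    using choose_subspace_between[of W' UNIV "n - d"] W' c by auto
  have "s < dim (G \<union> W)" if G: "G \<in> independent_subspaces X UNIV d" for G
  proof -
    have "dim (X \<union> G) + dim (X \<inter> G) = dim X + d" "dim (X \<union> G) = dim X + d"
      and dim_G: "subspace G" "dim G = d"
      using G X dim_Un_Int[of X G] by (auto simp: independent_subspaces_def mem_subspaces_of_dim)
    then have "dim (W' \<inter> G) = 0"
      using X(2) by auto
    then have "dim (W' \<union> G) = c + d"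
      using dim_Un_Int[OF W'(1) dim_G(1)] W'(3) dim_G(2) by linarith
    moreover have "dim (W' \<union> G) \<le> dim (G \<union> W)"
      using W'(2) by (intro dim_subset) auto
    ultimately show ?thesis using c by linarith
  qed
  then have "independent_subspaces X UNIV d \<subseteq> {G \<in> subspaces_of_dim scale d. s < dim (G \<union> W)}"
    by (auto simp: independent_subspaces_def)
  then have "card (independent_subspaces X UNIV d) \<le>
      card {G \<in> subspaces_of_dim scale d. s < dim (G \<union> W)}"
    by (intro card_mono) auto
  then show ?thesis
    using card_complements[OF X(1), of d] X(3) c by simp
qed

lemma s_union_refines_dim_Un_le:
  assumes "\<F> \<subseteq> all_subspaces scale" "s_union scale s \<F>" "refines \<G> \<F>" "W \<in> \<F>" "G \<in> \<G>"
  shows "dim (G \<union> W) \<le> s"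
proof -
  obtain F where F: "F \<in> \<F>" "G \<subseteq> F"
    using assms(3,5) by (auto simp: refines_def)
  then have "dim (G \<union> W) \<le> dim (F \<union> W)"
    by (intro dim_subset) auto
  also have "\<dots> \<le> s"
    using assms(2,4) F(1) unfolding s_union_iff[OF assms(1)] by blast
  finally show ?thesis .
qed

lemma low_antichain_avoiding_card_less:
  assumes \<G>: "\<G> \<subseteq> all_subspaces scale" "subspace_antichain \<G>" "\<forall>G\<in>\<G>. dim G \<le> Suc l"
    and \<D>: "\<D> \<subseteq> subspaces_of_dim scale (Suc l)" "\<D> \<inter> \<G> = {}"
    and large: "gauss_binomial q (n - l) 1 < real (card \<D>)" and l: "2 * l + 3 \<le> n"
  shows "real (card \<G>) < family_A_size (Suc l)"
proof (cases "\<G> \<subseteq> subspaces_of_dim scale (Suc l)")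
  case True
  then have "card \<G> + card \<D> \<le> card (subspaces_of_dim scale (Suc l))"
    using \<D> by (subst card_Un_disjoint[symmetric]) (auto intro: card_mono)
  then have "real (card \<G>) + real (card \<D>) \<le> gauss_binomial q n (Suc l)"
    using card_subspaces_of_dim[of "Suc l"] l by simp
  then show ?thesis
    using large family_A_size_Suc[of l] l by simp
next
  case False
  have "\<not> is_family_A scale (2 * Suc l) \<G>"
  proof
    assume "is_family_A scale (2 * Suc l) \<G>"
    then obtain U where U: "U \<in> subspaces_of_dim scale l"
      and "\<G> = insert U (subspaces_of_dim scale (Suc l) - upper_shadow scale l {U})"
      unfolding is_family_A_even_iff by blast
    then have "card \<D> \<le> card (upper_shadow scale l {U})"
      using \<D> by (intro card_mono) auto
    then show False using card_covers[OF U] large by simp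
  qed
  then show ?thesis
    using low_antichain_bound[OF \<G> False l] by force
qed

section \<open>Extremal families\<close>

lemma s_union_antichain_bound:
  assumes sub: "\<F> \<subseteq> all_subspaces scale" and antichain: "subspace_antichain \<F>"
    and union: "s_union scale s \<F>" and s: "2 \<le> s" "s < n"
  shows "real (card \<F>) \<le> gauss_binomial q n (s div 2)"
    and "real (card \<F>) = gauss_binomial q n (s div 2) \<Longrightarrow> F \<in> \<F> \<Longrightarrow>
      dim F \<in> {s div 2..s - s div 2}"
proof -
  define l where "l = s div 2 - 1"
  have d: "s div 2 = Suc l" and l: "s \<le> 2 * Suc l + 1" "Suc l \<le> s" "2 * l + 3 \<le> n"
    using s by (auto simp: l_def)
  obtain \<G> where \<G>: "\<G> \<subseteq> all_subspaces scale" "subspace_antichain \<G>" "\<forall>G\<in>\<G>. dim G \<le> Suc l"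
    and card_le: "card \<F> \<le> card \<G>" and refines: "refines \<G> \<F>"
    and low: "{F \<in> \<F>. dim F < Suc l} \<subseteq> \<G>"
    using obtain_low_antichain[OF sub antichain union l(1)] .
  have less: "real (card \<G>) < gauss_binomial q n (Suc l)"
    if "\<G> \<noteq> subspaces_of_dim scale (Suc l)"
    using low_antichain_card_less[OF \<G> that l(3)] .
  have "real (card (subspaces_of_dim scale (Suc l))) = gauss_binomial q n (Suc l)"
    using l by (intro card_subspaces_of_dim) simp
  then show "real (card \<F>) \<le> gauss_binomial q n (s div 2)"
    using less card_le unfolding d by force
  assume "real (card \<F>) = gauss_binomial q n (s div 2)" and F: "F \<in> \<F>"
  then have \<G>_eq: "\<G> = subspaces_of_dim scale (Suc l)"
    using less card_le unfolding d by force
  then have "Suc l \<le> dim F"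
    using low F by (force simp: mem_subspaces_of_dim)
  moreover have "dim F \<le> s - Suc l"
  proof (rule ccontr)
    assume "\<not> dim F \<le> s - Suc l"
    then have "q ^ (Suc l * (n - Suc l)) \<le> card {G \<in> \<G>. s < dim (G \<union> F)}"
      unfolding \<G>_eq using sub F s l
      by (intro card_large_joins_ge) (auto simp: all_subspaces_def)
    moreover have "{G \<in> \<G>. s < dim (G \<union> F)} = {}"
      using s_union_refines_dim_Un_le[OF sub union refines F] by (auto simp: not_less)
    ultimately show False using q_ge_2 by simp
  qed
  ultimately show "dim F \<in> {s div 2..s - s div 2}" by (simp add: d)
qed

lemma even_union_antichain_card_less:
  assumes sub: "\<F> \<subseteq> all_subspaces scale" and antichain: "subspace_antichain \<F>"
    and union: "s_union scale (2 * d) \<F>" and d: "2 \<le> d" "2 * d < n"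
    and W: "W \<in> \<F>" "d < dim W"
  shows "real (card \<F>) < family_A_size d"
proof -
  obtain l where d_eq: "d = Suc l" and l: "2 * l + 3 \<le> n"
    using d by (cases d) auto
  have "2 * d \<le> 2 * Suc l + 1" using d_eq by simp
  then obtain \<G> where \<G>: "\<G> \<subseteq> all_subspaces scale" "subspace_antichain \<G>" "\<forall>G\<in>\<G>. dim G \<le> Suc l"
    and card_le: "card \<F> \<le> card \<G>" and refines: "refines \<G> \<F>"
    by (rule obtain_low_antichain[OF sub antichain union])
  let ?\<D> = "{G \<in> subspaces_of_dim scale d. 2 * d < dim (G \<union> W)}"
  have "q ^ (d * (n - d)) \<le> card ?\<D>"
    using W sub d by (intro card_large_joins_ge) (auto simp: all_subspaces_def)
  then have "real (q ^ (d * (n - d))) \<le> real (card ?\<D>)"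
    by (simp only: of_nat_le_iff)
  moreover have "gauss_binomial q (Suc (n - d)) 1 < real (q ^ (d * (n - d)))"
    using d q_ge_2 by (intro gauss_binomial_Suc_1_less_power) simp_all
  moreover have "Suc (n - d) = n - l"
    using d_eq l by simp
  ultimately have "gauss_binomial q (n - l) 1 < real (card ?\<D>)"
    by (simp only: order_less_le_trans)
  moreover have "?\<D> \<inter> \<G> = {}"
    using s_union_refines_dim_Un_le[OF sub union refines W(1)] by (auto dest: leD)
  ultimately have "real (card \<G>) < family_A_size d"
    using low_antichain_avoiding_card_less[OF \<G> _ _ _ l, of ?\<D>] unfolding d_eq by blast
  then show ?thesis using card_le by linarith
qed

lemma even_union_antichain_bound:
  assumes sub: "\<F> \<subseteq> all_subspaces scale" and antichain: "subspace_antichain \<F>"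
    and union: "s_union scale (2 * d) \<F>" and d: "2 \<le> d" "2 * d < n"
    and not_middle: "\<not> \<F> \<subseteq> subspaces_of_dim scale d"
  shows "real (card \<F>) \<le> family_A_size d"
    and "real (card \<F>) = family_A_size d \<longleftrightarrow> is_family_A scale (2 * d) \<F>"
proof -
  obtain l where d_eq: "d = Suc l" and l: "2 * l + 3 \<le> n"
    using d by (cases d) auto
  have "real (card \<F>) \<le> family_A_size d \<and>
    (real (card \<F>) = family_A_size d \<longrightarrow> is_family_A scale (2 * d) \<F>)"
  proof (cases "\<forall>F\<in>\<F>. dim F \<le> d")
    case True
    then show ?thesis
      using low_antichain_bound[of \<F> l] sub antichain not_middle l unfolding d_eq by blast
  next
    case False
    then show ?thesis
      using even_union_antichain_card_less[OF sub antichain union d] by fastforce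
  qed
  then show "real (card \<F>) \<le> family_A_size d"
    and "real (card \<F>) = family_A_size d \<longleftrightarrow> is_family_A scale (2 * d) \<F>"
    using card_family_A[of l \<F>] l unfolding d_eq by auto
qed

lemma two_union_antichain_bound:
  assumes "\<F> \<subseteq> all_subspaces scale" "subspace_antichain \<F>" "s_union scale 2 \<F>" "2 < n"
    and "\<not> \<F> \<subseteq> subspaces_of_dim scale 1"
  shows "real (card \<F>) \<le> gauss_binomial q n 1 - real q"
    and "real (card \<F>) = gauss_binomial q n 1 - real q \<longleftrightarrow> is_family_B scale 2 \<F>"
proof -
  obtain X where X: "\<F> = {X}"
    using two_union_antichain_singleton[OF assms(1-3,5)] .
  have "real q * 1 < real q * gauss_binomial q (n - 1) 1"
    using assms(4) q_ge_2 by (intro mult_strict_left_mono gauss_binomial_1_gt_1) auto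
  then have less: "real (card \<F>) < gauss_binomial q n 1 - real q"
    using gauss_binomial_Suc_1[OF q_ge_2, of "n - 1"] assms(4) by (simp add: X)
  then show "real (card \<F>) \<le> gauss_binomial q n 1 - real q" by simp
  show "real (card \<F>) = gauss_binomial q n 1 - real q \<longleftrightarrow> is_family_B scale 2 \<F>"
    using less not_is_family_B_2_singleton[of X] assms(4) by (simp add: X)
qed

lemma card_subspaces_of_dim_diff_shadow_Un:
  assumes "\<H> \<subseteq> subspaces_of_dim scale (Suc d)"
  shows "card (subspaces_of_dim scale d - shadow scale (Suc d) \<H> \<union> \<H>) +
    card (shadow scale (Suc d) \<H>) = card (subspaces_of_dim scale d) + card \<H>"
proof -
  have "card (subspaces_of_dim scale d - shadow scale (Suc d) \<H> \<union> \<H>) =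
      card (subspaces_of_dim scale d - shadow scale (Suc d) \<H>) + card \<H>"
    using assms by (intro card_Un_disjoint) (auto simp: mem_subspaces_of_dim)
  then show ?thesis
    using card_Diff_add[of "subspaces_of_dim scale d" "shadow scale (Suc d) \<H>"]
      shadow_subset_subspaces_of_dim[of scale d \<H>] by simp
qed

lemma even_union_antichain_extremal:
  assumes sub: "\<F> \<subseteq> all_subspaces scale" and antichain: "subspace_antichain \<F>"
    and union: "s_union scale s \<F>" and s: "2 \<le> s" "s < n" "even s"
    and eq: "real (card \<F>) = gauss_binomial q n (s div 2)"
  shows "\<F> = subspaces_of_dim scale (s div 2)"
proof -
  have "s - s div 2 = s div 2"
    using \<open>even s\<close> by (auto elim: evenE)
  then have "dim F = s div 2" if "F \<in> \<F>" for F
    using s_union_antichain_bound(2)[OF sub antichain union s(1,2) eq that] by simp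
  then have "\<F> \<subseteq> subspaces_of_dim scale (s div 2)"
    using sub by (auto simp: all_subspaces_def mem_subspaces_of_dim)
  moreover have "card \<F> = card (subspaces_of_dim scale (s div 2))"
    using eq card_subspaces_of_dim[of "s div 2"] s(2) by linarith
  ultimately show ?thesis by (simp add: card_subset_eq)
qed

lemma odd_union_antichain_extremal:
  assumes sub: "\<F> \<subseteq> all_subspaces scale" and antichain: "subspace_antichain \<F>"
    and union: "s_union scale (2 * d + 1) \<F>" and d: "1 \<le> d" "2 * d + 1 < n"
    and eq: "real (card \<F>) = gauss_binomial q n d"
  obtains \<H> where "\<H> \<subseteq> subspaces_of_dim scale (Suc d)"
    "\<F> = subspaces_of_dim scale d - shadow scale (Suc d) \<H> \<union> \<H>"
    "card (shadow scale (Suc d) \<H>) = card \<H>"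
proof -
  let ?H = "\<F> \<inter> subspaces_of_dim scale (Suc d)"
  let ?E = "subspaces_of_dim scale d - shadow scale (Suc d) ?H \<union> ?H"
  have "dim F \<in> {d..Suc d}" if "F \<in> \<F>" for F
    using s_union_antichain_bound(2)[OF sub antichain union _ _ _ that] eq d by simp
  then have "\<F> \<subseteq> subspaces_of_dim scale d \<union> subspaces_of_dim scale (Suc d)"
    using sub by (force simp: all_subspaces_def mem_subspaces_of_dim)
  then have subset: "\<F> \<subseteq> ?E"
    using antichain_Int_shadow[OF antichain] by blast
  moreover have "card ?E + card (shadow scale (Suc d) ?H) = card \<F> + card ?H"
    using card_subspaces_of_dim_diff_shadow_Un[of ?H d] card_subspaces_of_dim[of d] eq d by simp
  moreover have "card \<F> \<le> card ?E"
    using subset by (intro card_mono) auto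
  moreover have "card ?H \<le> card (shadow scale (Suc d) ?H)"
    using card_le_card_shadow[OF sub union] by simp
  ultimately have card_E: "card \<F> = card ?E" and "card (shadow scale (Suc d) ?H) = card ?H"
    by linarith+
  moreover have "\<F> = ?E"
    using card_subset_eq[OF _ subset card_E] by simp
  ultimately show thesis by (intro that[of ?H]) auto
qed

lemma s_union_antichain_card_eq_iff:
  assumes sub: "\<F> \<subseteq> all_subspaces scale" and antichain: "subspace_antichain \<F>"
    and union: "s_union scale s \<F>" and s: "2 \<le> s" "s < n"
  shows "real (card \<F>) = gauss_binomial q n (s div 2) \<longleftrightarrow>
    \<F> = subspaces_of_dim scale (s div 2) \<or>
    (\<exists>d \<F>\<^sub>d \<F>\<^sub>d\<^sub>1. s = 2 * d + 1 \<and> \<F> = \<F>\<^sub>d \<union> \<F>\<^sub>d\<^sub>1 \<and>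
      \<F>\<^sub>d\<^sub>1 \<subseteq> subspaces_of_dim scale (d + 1) \<and>
      \<F>\<^sub>d = subspaces_of_dim scale d - shadow scale (d + 1) \<F>\<^sub>d\<^sub>1 \<and>
      card (shadow scale (d + 1) \<F>\<^sub>d\<^sub>1) = card \<F>\<^sub>d\<^sub>1)" (is "?eq \<longleftrightarrow> ?middle \<or> ?odd")
proof -
  have card_layer: "real (card (subspaces_of_dim scale (s div 2))) = gauss_binomial q n (s div 2)"
    using s by (intro card_subspaces_of_dim) simp
  have "?middle" if ?eq "even s"
    using even_union_antichain_extremal[OF sub antichain union s] that by blast
  moreover have "?odd" if ?eq "odd s"
  proof -
    obtain d where d: "s = 2 * d + 1" using \<open>odd s\<close> by (rule oddE)
    have "1 \<le> d" "2 * d + 1 < n" "real (card \<F>) = gauss_binomial q n d"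
      using d s \<open>?eq\<close> by auto
    then obtain \<H> where "\<H> \<subseteq> subspaces_of_dim scale (Suc d)"
      "\<F> = subspaces_of_dim scale d - shadow scale (Suc d) \<H> \<union> \<H>"
      "card (shadow scale (Suc d) \<H>) = card \<H>"
      by (rule odd_union_antichain_extremal[OF sub antichain union[unfolded d]])
    then show ?thesis
      using d by (intro exI[of _ d] exI[of _ "subspaces_of_dim scale d - shadow scale (Suc d) \<H>"]
          exI[of _ \<H>]) simp
  qed
  moreover have ?eq if ?middle
    using that card_layer by simp
  moreover have ?eq if ?odd
  proof -
    obtain d \<H> where d: "s = 2 * d + 1" and \<H>: "\<H> \<subseteq> subspaces_of_dim scale (d + 1)"
      and "\<F> = subspaces_of_dim scale d - shadow scale (d + 1) \<H> \<union> \<H>"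
      and "card (shadow scale (d + 1) \<H>) = card \<H>"
      using \<open>?odd\<close> by blast
    then have "card \<F> = card (subspaces_of_dim scale d)"
      using card_subspaces_of_dim_diff_shadow_Un[of \<H> d] by simp
    then show ?thesis using card_layer d by simp
  qed
  ultimately show ?thesis by blast
qed

end

theorem theorem6:
  fixes scale :: "'a :: {field, finite} \<Rightarrow> 'b :: ab_group_add \<Rightarrow> 'b"
    and q n s :: nat
    and \<F> :: "'b set set"
  assumes "vector_space scale"
    and "q = CARD('a)"
    and "vector_space.dim scale (UNIV :: 'b set) = n"
    and "2 \<le> s" and "s < n"
    and "\<F> \<subseteq> all_subspaces scale"
    and "s_union scale s \<F>"
    and "subspace_antichain \<F>"
  shows
    "(real (card \<F>) \<le> gauss_binomial q n (s div 2) \<and>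
      (real (card \<F>) = gauss_binomial q n (s div 2) \<longleftrightarrow>
        \<F> = subspaces_of_dim scale (s div 2) \<or>
        (\<exists>d \<F>\<^sub>d \<F>\<^sub>d\<^sub>1. s = 2 * d + 1 \<and> \<F> = \<F>\<^sub>d \<union> \<F>\<^sub>d\<^sub>1 \<and>
          \<F>\<^sub>d\<^sub>1 \<subseteq> subspaces_of_dim scale (d + 1) \<and>
          \<F>\<^sub>d = subspaces_of_dim scale d - shadow scale (d + 1) \<F>\<^sub>d\<^sub>1 \<and>
          card (shadow scale (d + 1) \<F>\<^sub>d\<^sub>1) = card \<F>\<^sub>d\<^sub>1))) \<and>
     (\<forall>d. s = 2 * d \<and> \<not> \<F> \<subseteq> subspaces_of_dim scale d \<longrightarrow>
        (d = 1 \<longrightarrow>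
          real (card \<F>) \<le> gauss_binomial q n 1 - real q \<and>
          (real (card \<F>) = gauss_binomial q n 1 - real q \<longleftrightarrow>
            is_family_B scale 2 \<F>)) \<and>
        (d \<ge> 2 \<longrightarrow>
          real (card \<F>) \<le> gauss_binomial q n d - real q * gauss_binomial q (n - d) 1 \<and>
          (real (card \<F>) = gauss_binomial q n d - real q * gauss_binomial q (n - d) 1 \<longleftrightarrow>
            is_family_A scale (2 * d) \<F>)))"
proof -
  interpret vector_space scale by fact
  obtain Basis where Basis: "independent Basis" "UNIV \<subseteq> span Basis" "card Basis = n"
    using basis_exists[of UNIV] assms(3) by metis
  have "finite Basis"
    using Basis(3) assms(5) by (metis card.infinite not_less_zero)
  then interpret finite_field_space scale Basis q n
    using Basis assms(2) by unfold_locales auto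
  note \<F> = assms(6,8,7)
  have "real (card \<F>) \<le> gauss_binomial q n 1 - real q \<and>
      (real (card \<F>) = gauss_binomial q n 1 - real q \<longleftrightarrow> is_family_B scale 2 \<F>)"
    if "s = 2" "\<not> \<F> \<subseteq> subspaces_of_dim scale 1"
    using two_union_antichain_bound[of \<F>] \<F> assms(5) that by simp
  moreover have "real (card \<F>) \<le> family_A_size d \<and>
      (real (card \<F>) = family_A_size d \<longleftrightarrow> is_family_A scale (2 * d) \<F>)"
    if "s = 2 * d" "\<not> \<F> \<subseteq> subspaces_of_dim scale d" "2 \<le> d" for d
    using even_union_antichain_bound[of \<F> d] \<F> assms(5) that by simp
  ultimately show ?thesis
    using s_union_antichain_bound(1)[OF \<F> assms(4,5)]
      s_union_antichain_card_eq_iff[OF \<F> assms(4,5)] by auto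
qed

end
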